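(* Let $n,r,k$ be positive integers with $rn-k>0$. Then $G_n^{(r,k)}$ is the Frobenius characteristic of the action of $\mathfrak{S}_n$, by permuting coordinates, on the set $S_n^{(r,k)}$ of $n$-tuples of integers whose increasing rearrangement has the form \[(\underbrace{w,\dots,w}_{q(w)},b_{q(w)+1},b_{q(w)+2},\dots,b_n),\] where $w\in\{1,\dots,k\}$, $q(w)$ is the smallest integer such that $w\le q(w)r$, and \[b_j\le\min\{(j-1)r,\;w-1+rn-k\}\quad\text{for } q(w)+1\le j\le n.\] Equivalently, a weakly increasing integer vector $(b_1,\dots,b_n)$ lies in $S_n^{(r,k)}$ iff (I) $b_1=w$ for some $w\in\{1,\dots,k\}$ and $b_n-b_1<rn-k$; (II) $b_{q(w)}=w$; (III) $b_j\le(j-1)r$ for all $j\in\{1,\dots,n\}$ with $b_j>w$.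
   Context: For positive integers $r,k$, an $(r,k)$-parking function of length $m$ is a sequence $(a_1,\dots,a_m)$ of positive integers whose increasing rearrangement $b_1\le\cdots\le b_m$ satisfies $b_i\le k+(i-1)r$. $F_m^{(r,k)}$ is the Frobenius characteristic of the action of $\mathfrak{S}_m$ on the $(r,k)$-parking functions of length $m$ by permuting coordinates, $F_0^{(r,k)}=1$, and $\mathcal{P}^{(r,1)}(t)=\sum_{m\ge0}F_m^{(r,1)}t^m$. For integers $k\ge0$ the symmetric functions $G_m^{(r,k)}$ ($m\ge1$) are defined by $\mathcal{P}^{(r,1)}(t)^{-k}=1-\sum_{m\ge1}G_m^{(r,k)}t^m$. *)

theory Defs
  imports
    "HOL-Combinatorics.Permutations"
    "HOL-Combinatorics.Orbits"
    "HOL-Computational_Algebra.Formal_Power_Series"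
begin

section \<open>The ring of symmetric functions over the rationals\<close>

text \<open>A monomial in the variables \<open>x\<^sub>0, x\<^sub>1, \<dots>\<close> is a multiset of
  indices, and a formal power series in these variables is its coefficient function. A symmetric
  function is a power series of bounded degree that is invariant under permuting the variables.\<close>

definition is_symfun :: "(nat multiset \<Rightarrow> rat) \<Rightarrow> bool" where
  "is_symfun f \<longleftrightarrow>
     (\<exists>d. \<forall>M. d < size M \<longrightarrow> f M = 0) \<and>
     (\<forall>\<pi>. bij \<pi> \<longrightarrow> (\<forall>M. f (image_mset \<pi> M) = f M))"

lemma finite_submultisets: "finite {A. A \<subseteq># M}"
proof (induction M)
  case (add x M)
  have "{A. A \<subseteq># add_mset x M} \<subseteq> {A. A \<subseteq># M} \<union> add_mset x ` {A. A \<subseteq># M}"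
  proof
    fix A assume A: "A \<in> {A. A \<subseteq># add_mset x M}"
    show "A \<in> {A. A \<subseteq># M} \<union> add_mset x ` {A. A \<subseteq># M}"
    proof (cases "x \<in># A")
      case True
      then have "A = add_mset x (A - {#x#})" by simp
      moreover from this A have "A - {#x#} \<subseteq># M"
        by (metis mem_Collect_eq mset_subset_eq_add_mset_cancel)
      ultimately show ?thesis by blast
    next
      case False
      have "count A y \<le> count M y" for y
        using mset_subset_eq_count[of A "add_mset x M" y] A False
        by (cases "y = x") (auto simp: not_in_iff)
      then show ?thesis by (auto simp: subseteq_mset_def)
    qed
  qed
  then show ?case using add.IH by (meson finite_Un finite_imageI finite_subset)
qed simp

definition conv_mset :: "(nat multiset \<Rightarrow> rat) \<Rightarrow> (nat multiset \<Rightarrow> rat) \<Rightarrow> nat multiset \<Rightarrow> rat" where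
  "conv_mset f g M = (\<Sum>A | A \<subseteq># M. f A * g (M - A))"

lemma conv_mset_commute: "conv_mset f g M = conv_mset g f M"
proof -
  have "M - (M - A) = A" if "A \<subseteq># M" for A
    using that by (metis add_diff_cancel_left' subset_mset.diff_add)
  then show ?thesis
    unfolding conv_mset_def
    by (intro sum.reindex_bij_witness[of _ "\<lambda>A. M - A" "\<lambda>A. M - A"]) (simp_all add: mult.commute)
qed

lemma conv_mset_assoc: "conv_mset (conv_mset f g) h M = conv_mset f (conv_mset g h) M"
proof -
  have "conv_mset (conv_mset f g) h M =
      (\<Sum>(A, B)\<in>Sigma {A. A \<subseteq># M} (\<lambda>A. {B. B \<subseteq># A}). f B * g (A - B) * h (M - A))"
    by (simp add: conv_mset_def sum_distrib_right sum.Sigma finite_submultisets)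
  also have "\<dots> =
      (\<Sum>(A, B)\<in>Sigma {A. A \<subseteq># M} (\<lambda>A. {B. B \<subseteq># M - A}). f A * (g B * h (M - A - B)))"
  proof (rule sum.reindex_bij_witness[of _ "\<lambda>(A, B). (A + B, A)" "\<lambda>(A, B). (B, A - B)"], goal_cases)
    case (1 p)
    then show ?case by (clarsimp simp: subset_mset.add_diff_inverse)
  next
    case (2 p)
    then show ?case
      by (clarsimp simp: subseteq_mset_def) (meson diff_le_mono order_trans)
  next
    case (3 p)
    then show ?case by clarsimp
  next
    case (4 p)
    then show ?case
      by (clarsimp simp: subset_mset.le_diff_conv2 add.commute)
  next
    case (5 p)
    then obtain A B where p: "p = (A, B)" and sub: "A \<subseteq># M" "B \<subseteq># A" by blast
    have "M - B - (A - B) = M - A"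
      using sub by (metis diff_diff_add subset_mset.add_diff_inverse)
    then show ?case by (simp add: p mult.assoc)
  qed
  also have "\<dots> = conv_mset f (conv_mset g h) M"
    by (simp add: conv_mset_def sum_distrib_left sum.Sigma finite_submultisets)
  finally show ?thesis .
qed

lemma is_symfun_conv:
  assumes f: "is_symfun f" and g: "is_symfun g"
  shows "is_symfun (conv_mset f g)"
  unfolding is_symfun_def
proof (intro conjI allI impI)
  obtain d e where d: "\<And>M. d < size M \<Longrightarrow> f M = 0" and e: "\<And>M. e < size M \<Longrightarrow> g M = 0"
    using f g unfolding is_symfun_def by blast
  have "conv_mset f g M = 0" if M: "d + e < size M" for M
    unfolding conv_mset_def
  proof (rule sum.neutral, rule ballI)
    fix A assume "A \<in> {A. A \<subseteq># M}"
    then have "size M = size A + size (M - A)"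
      by (simp add: size_Diff_submset size_mset_mono)
    then have "d < size A \<or> e < size (M - A)" using M by linarith
    then show "f A * g (M - A) = 0" using d e by auto
  qed
  then show "\<exists>d. \<forall>M. d < size M \<longrightarrow> conv_mset f g M = 0" by blast
next
  fix \<pi> :: "nat \<Rightarrow> nat" and M :: "nat multiset"
  assume \<pi>: "bij \<pi>"
  have inv: "image_mset (inv \<pi>) (image_mset \<pi> A) = A" "image_mset \<pi> (image_mset (inv \<pi>) A) = A"
    for A using \<pi> by (simp_all add: multiset.map_comp bij_is_inj bij_is_surj surj_iff[symmetric]
        inj_iff[symmetric] comp_def inv_f_f surj_f_inv_f)
  have f': "f (image_mset \<pi> A) = f A" and g': "g (image_mset \<pi> A) = g A" for A
    using f g \<pi> unfolding is_symfun_def by blast+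
  show "conv_mset f g (image_mset \<pi> M) = conv_mset f g M"
    unfolding conv_mset_def
  proof (rule sum.reindex_bij_witness[of _ "image_mset \<pi>" "image_mset (inv \<pi>)"])
    fix A assume A: "A \<in> {A. A \<subseteq># image_mset \<pi> M}"
    show "image_mset \<pi> (image_mset (inv \<pi>) A) = A" by (rule inv)
    show sub: "image_mset (inv \<pi>) A \<in> {A. A \<subseteq># M}"
      using A image_mset_subseteq_mono[of A "image_mset \<pi> M" "inv \<pi>"] by (simp only: mem_Collect_eq inv)
    have "f A = f (image_mset (inv \<pi>) A)" using f'[of "image_mset (inv \<pi>) A"] by (simp only: inv)
    moreover have "image_mset \<pi> (M - image_mset (inv \<pi>) A) = image_mset \<pi> M - A"
      using sub by (simp only: image_mset_Diff mem_Collect_eq inv)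
    then have "g (image_mset \<pi> M - A) = g (M - image_mset (inv \<pi>) A)"
      using g' by metis
    ultimately show "f (image_mset (inv \<pi>) A) * g (M - image_mset (inv \<pi>) A) =
        f A * g (image_mset \<pi> M - A)" by simp
  next
    fix A assume "A \<in> {A. A \<subseteq># M}"
    then show "image_mset \<pi> A \<in> {A. A \<subseteq># image_mset \<pi> M}"
      by (simp add: image_mset_subseteq_mono)
    show "image_mset (inv \<pi>) (image_mset \<pi> A) = A" by (rule inv)
  qed
qed

lemma is_symfun_zero: "is_symfun (\<lambda>_. 0)"
  by (simp add: is_symfun_def)

lemma is_symfun_one: "is_symfun (\<lambda>M. if M = {#} then 1 else 0)"
  by (auto simp: is_symfun_def intro!: exI[of _ 0])

lemma is_symfun_add:
  assumes "is_symfun f" "is_symfun g"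
  shows "is_symfun (\<lambda>M. f M + g M)"
proof -
  obtain d e where "\<And>M. d < size M \<Longrightarrow> f M = 0" "\<And>M. e < size M \<Longrightarrow> g M = 0"
    using assms unfolding is_symfun_def by blast
  then have "\<forall>M. max d e < size M \<longrightarrow> f M + g M = 0" by simp
  then show ?thesis using assms unfolding is_symfun_def by metis
qed

lemma is_symfun_scale: "is_symfun f \<Longrightarrow> is_symfun (\<lambda>M. c * f M)"
  unfolding is_symfun_def by (metis mult_zero_right)

lemma is_symfun_power_sum:
  "is_symfun (\<lambda>M. if \<exists>i. M = replicate_mset k i then 1 else 0)" (is "is_symfun ?p")
  unfolding is_symfun_def
proof (intro conjI allI impI)
  show "\<exists>d. \<forall>M. d < size M \<longrightarrow> ?p M = 0" by (rule exI[of _ k]) auto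
next
  fix \<pi> :: "nat \<Rightarrow> nat" and M assume \<pi>: "bij \<pi>"
  have inj: "inj (image_mset \<pi>)"
    using \<pi> by (metis bij_is_inj multiset.inj_map)
  have "(\<exists>i. image_mset \<pi> M = replicate_mset k i) \<longleftrightarrow>
      (\<exists>i. image_mset \<pi> M = replicate_mset k (\<pi> i))"
    using \<pi> by (metis bij_pointE)
  also have "\<dots> \<longleftrightarrow> (\<exists>i. M = replicate_mset k i)"
    using inj by (metis image_replicate_mset injD)
  finally show "?p (image_mset \<pi> M) = ?p M" by simp
qed

typedef symfun = "{f. is_symfun f}"
  morphisms coeff_sym Abs_symfun
  using is_symfun_zero by blast

setup_lifting type_definition_symfun

instantiation symfun :: comm_ring_1
begin

lift_definition zero_symfun :: symfun is "\<lambda>_. 0"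
  by (rule is_symfun_zero)

lift_definition one_symfun :: symfun is "\<lambda>M. if M = {#} then 1 else 0"
  by (rule is_symfun_one)

lift_definition plus_symfun :: "symfun \<Rightarrow> symfun \<Rightarrow> symfun" is "\<lambda>f g M. f M + g M"
  by (rule is_symfun_add)

lift_definition uminus_symfun :: "symfun \<Rightarrow> symfun" is "\<lambda>f M. - f M"
  by (simp add: is_symfun_def)

lift_definition minus_symfun :: "symfun \<Rightarrow> symfun \<Rightarrow> symfun" is "\<lambda>f g M. f M - g M"
  subgoal for f g
    using is_symfun_add[OF _ is_symfun_scale[of g "-1"], of f] by simp
  done

lift_definition times_symfun :: "symfun \<Rightarrow> symfun \<Rightarrow> symfun" is conv_mset
  by (rule is_symfun_conv)

instance
proof
  fix a b c :: symfun
  show "a * b * c = a * (b * c)" by transfer (rule ext, rule conv_mset_assoc)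
  show "a * b = b * a" by transfer (rule ext, rule conv_mset_commute)
  show "1 * a = a"
  proof (transfer, rule ext)
    fix f :: "nat multiset \<Rightarrow> rat" and M
    have "conv_mset (\<lambda>M. if M = {#} then 1 else 0) f M =
        (\<Sum>A | A \<subseteq># M. if A = {#} then f (M - A) else 0)"
      unfolding conv_mset_def by (rule sum.cong) auto
    also have "\<dots> = f M" by (simp add: sum.delta' sum.delta finite_submultisets)
    finally show "conv_mset (\<lambda>M. if M = {#} then 1 else 0) f M = f M" .
  qed
  show "(a + b) * c = a * c + b * c"
    by transfer (simp add: conv_mset_def fun_eq_iff distrib_right sum.distrib)
  show "a + b + c = a + (b + c)" by transfer (simp add: algebra_simps)
  show "a + b = b + a" by transfer (simp add: algebra_simps)
  show "0 + a = a" by transfer simp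
  show "- a + a = 0" by transfer simp
  show "a - b = a + - b" by transfer simp
  show "(0::symfun) \<noteq> 1" by transfer (metis zero_neq_one)
qed

end

lift_definition scale_sym :: "rat \<Rightarrow> symfun \<Rightarrow> symfun" is "\<lambda>c f M. c * f M"
  by (rule is_symfun_scale)

text \<open>\<open>power_sum k\<close> is \<open>x\<^sub>0^k + x\<^sub>1^k + \<dots>\<close>, for \<open>k \<ge> 1\<close>.\<close>

lift_definition power_sum :: "nat \<Rightarrow> symfun" is
  "\<lambda>k M. if \<exists>i. M = replicate_mset k i then 1 else 0"
  by (rule is_symfun_power_sum)


section \<open>The Frobenius characteristic of a coordinate-permuting action\<close>

text \<open>The power sum indexed by the cycle type of a permutation of \<open>{..<n}\<close>; the orbits of its
  points are its cycles, fixed points included.\<close>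

definition power_sum_cycle_type :: "nat \<Rightarrow> (nat \<Rightarrow> nat) \<Rightarrow> symfun" where
  "power_sum_cycle_type n \<sigma> = (\<Prod>c\<in>orbit \<sigma> ` {..<n}. power_sum (card c))"

definition frobenius_ch :: "nat \<Rightarrow> ((nat \<Rightarrow> nat) \<Rightarrow> rat) \<Rightarrow> symfun" where
  "frobenius_ch n \<chi> =
     scale_sym (1 / fact n) (\<Sum>\<sigma> | \<sigma> permutes {..<n}. scale_sym (\<chi> \<sigma>) (power_sum_cycle_type n \<sigma>))"

text \<open>The inverse makes this a left action:
  \<open>\<sigma> (a\<^sub>1, \<dots>, a\<^sub>n) = (a\<^bsub>\<sigma>\<^sup>-\<^sup>1 1\<^esub>, \<dots>, a\<^bsub>\<sigma>\<^sup>-\<^sup>1 n\<^esub>)\<close>.\<close>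

definition permute_coords :: "(nat \<Rightarrow> nat) \<Rightarrow> 'a list \<Rightarrow> 'a list" where
  "permute_coords \<sigma> xs = permute_list (inv \<sigma>) xs"

text \<open>The character of the permutation representation on a finite stable set of tuples.\<close>

definition perm_character :: "'a list set \<Rightarrow> (nat \<Rightarrow> nat) \<Rightarrow> rat" where
  "perm_character X \<sigma> = of_nat (card {x \<in> X. permute_coords \<sigma> x = x})"

definition frobenius_ch_action :: "nat \<Rightarrow> 'a list set \<Rightarrow> symfun" where
  "frobenius_ch_action n X = frobenius_ch n (perm_character X)"


section \<open>Parking functions\<close>

text \<open>The increasing rearrangement \<open>b\<^sub>1 \<le> \<dots> \<le> b\<^sub>m\<close> of \<open>a\<close> is \<open>sort a\<close>,
  with \<open>b\<^sub>j = sort a ! (j - 1)\<close>.\<close>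

definition parking_functions :: "nat \<Rightarrow> nat \<Rightarrow> nat \<Rightarrow> int list set" where
  "parking_functions r k m =
     {a. length a = m \<and> (\<forall>x\<in>set a. 1 \<le> x) \<and>
         (\<forall>j\<in>{1..m}. sort a ! (j - 1) \<le> int k + (int j - 1) * int r)}"

definition park_ch :: "nat \<Rightarrow> nat \<Rightarrow> nat \<Rightarrow> symfun" where
  "park_ch r k m = frobenius_ch_action m (parking_functions r k m)"

definition PF_series :: "nat \<Rightarrow> symfun fps" where
  "PF_series r = Abs_fps (\<lambda>m. park_ch r 1 m)"

text \<open>Since \<^const>\<open>inverse\<close> on power series needs an inverse on the coefficients, the reciprocal
  of a series with constant term 1 is taken with \<^const>\<open>fps_right_inverse\<close>.
  Only \<open>G_sym r k m\<close> with \<open>m \<ge> 1\<close> is meaningful.\<close>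

definition G_sym :: "nat \<Rightarrow> nat \<Rightarrow> nat \<Rightarrow> symfun" where
  "G_sym r k m = - fps_nth (fps_right_inverse (PF_series r ^ k) 1) m"

definition q_min :: "nat \<Rightarrow> int \<Rightarrow> nat" where
  "q_min r w = (LEAST i::nat. w \<le> int i * int r)"

definition S_tuples :: "nat \<Rightarrow> nat \<Rightarrow> nat \<Rightarrow> int list set" where
  "S_tuples r k n =
     {a. length a = n \<and>
         (\<exists>w\<in>{1..int k}.
            take (q_min r w) (sort a) = replicate (q_min r w) w \<and>
            (\<forall>j\<in>{q_min r w + 1..n}.
               sort a ! (j - 1) \<le> min ((int j - 1) * int r) (w - 1 + int r * int n - int k)))}"


section \<open>Well-definedness\<close>

lemma permute_coords_compose:
  assumes "\<sigma> permutes {..<length xs}" "\<tau> permutes {..<length xs}"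
  shows "permute_coords (\<sigma> \<circ> \<tau>) xs = permute_coords \<sigma> (permute_coords \<tau> xs)"
proof -
  have "inv (\<sigma> \<circ> \<tau>) = inv \<tau> \<circ> inv \<sigma>"
    using assms by (simp add: o_inv_distrib permutes_bij)
  then show ?thesis
    by (simp add: permute_coords_def permute_list_compose permutes_inv assms)
qed

lemma sort_permute_coords:
  fixes xs :: "int list"
  assumes "\<sigma> permutes {..<length xs}"
  shows "sort (permute_coords \<sigma> xs) = sort xs"
  using assms
  by (intro properties_for_sort) (simp_all add: permute_coords_def permutes_inv)

lemma permute_coords_parking_functions:
  assumes "\<sigma> permutes {..<m}" "a \<in> parking_functions r k m"
  shows "permute_coords \<sigma> a \<in> parking_functions r k m"
proof -
  have len: "\<sigma> permutes {..<length a}" using assms by (simp add: parking_functions_def)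
  then have "set (permute_coords \<sigma> a) = set a" "length (permute_coords \<sigma> a) = length a"
    by (simp_all add: permute_coords_def permutes_inv)
  then show ?thesis
    using assms(2) sort_permute_coords[OF len] by (simp add: parking_functions_def)
qed

lemma permute_coords_S_tuples:
  assumes "\<sigma> permutes {..<n}" "a \<in> S_tuples r k n"
  shows "permute_coords \<sigma> a \<in> S_tuples r k n"
proof -
  have len: "\<sigma> permutes {..<length a}" using assms by (simp add: S_tuples_def)
  have "length (permute_coords \<sigma> a) = length a" by (simp add: permute_coords_def)
  then show ?thesis
    using assms(2) sort_permute_coords[OF len] by (simp add: S_tuples_def)
qed

lemma finite_parking_functions: "finite (parking_functions r k m)"
proof (rule finite_subset)
  show "parking_functions r k m \<subseteq>
      {xs. set xs \<subseteq> {1..int k + int m * int r} \<and> length xs = m}"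
  proof
    fix a assume a: "a \<in> parking_functions r k m"
    have "x \<le> int k + int m * int r" if "x \<in> set a" for x
    proof -
      have len: "length a = m" using a by (simp add: parking_functions_def)
      from that have "x \<in> set (sort a)" by simp
      then obtain i where i: "i < m" "x = sort a ! i"
        using len unfolding in_set_conv_nth length_sort by blast
      then have "x \<le> int k + (int (Suc i) - 1) * int r"
        using a by (auto simp: parking_functions_def dest!: bspec[of _ _ "Suc i"])
      also have "\<dots> \<le> int k + int m * int r"
        using i by (simp add: mult_right_mono)
      finally show ?thesis .
    qed
    then show "a \<in> {xs. set xs \<subseteq> {1..int k + int m * int r} \<and> length xs = m}"
      using a by (auto simp: parking_functions_def)
  qed
qed (rule finite_lists_length_eq, simp)

lemma q_min:
  assumes "0 < r"
  shows "w \<le> int (q_min r w) * int r" "i < q_min r w \<Longrightarrow> int i * int r < w"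
proof -
  have "w \<le> int (nat w) * int r"
  proof -
    have "int (nat w) * 1 \<le> int (nat w) * int r"
      using assms by (intro mult_left_mono) auto
    then show ?thesis by linarith
  qed
  then show "w \<le> int (q_min r w) * int r" unfolding q_min_def by (rule LeastI)
  show "int i * int r < w" if "i < q_min r w"
    using not_less_Least[OF that[unfolded q_min_def]] by simp
qed

lemma finite_S_tuples:
  assumes "0 < r"
  shows "finite (S_tuples r k n)"
proof (rule finite_subset)
  show "S_tuples r k n \<subseteq> {xs. set xs \<subseteq> {1..int k + int r * int n} \<and> length xs = n}"
  proof
    fix a assume a: "a \<in> S_tuples r k n"
    then obtain w where w: "1 \<le> w" "w \<le> int k"
      and take: "take (q_min r w) (sort a) = replicate (q_min r w) w"
      and rest: "\<And>j. q_min r w + 1 \<le> j \<Longrightarrow> j \<le> n \<Longrightarrow> sort a ! (j - 1) \<le> w - 1 + int r * int n - int k"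
      unfolding S_tuples_def by fastforce
    have len: "length a = n" using a by (simp add: S_tuples_def)
    have "q_min r w \<noteq> 0"
    proof
      assume "q_min r w = 0"
      then show False using q_min(1)[OF assms, of w] w by simp
    qed
    then have q: "0 < q_min r w" by simp
    then have "take (q_min r w) (sort a) \<noteq> []" using take by simp
    then have n: "0 < n" using len by (metis length_0_conv length_sort neq0_conv take_Nil)
    have eq: "sort a ! i = w" if "i < q_min r w" for i
      using that take by (metis nth_replicate nth_take)
    have "1 \<le> x \<and> x \<le> int k + int r * int n" if "x \<in> set a" for x
    proof -
      from that have "x \<in> set (sort a)" by simp
      then obtain i where i: "i < n" "x = sort a ! i"
        using len unfolding in_set_conv_nth length_sort by blast
      have "sort a ! 0 \<le> sort a ! i"
        using i len by (intro sorted_nth_mono) auto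
      then have "1 \<le> x" using eq[OF q] w i by simp
      moreover have "x \<le> int k + int r * int n"
      proof (cases "i < q_min r w")
        case True
        have "0 \<le> int r * int n" by simp
        then show ?thesis using eq[OF True] w i by linarith
      next
        case False
        then show ?thesis using rest[of "Suc i"] w i by simp
      qed
      ultimately show ?thesis ..
    qed
    then show "a \<in> {xs. set xs \<subseteq> {1..int k + int r * int n} \<and> length xs = n}"
      using len by auto
  qed
qed (rule finite_lists_length_eq, simp)

lemma park_ch_0: "park_ch r k 0 = 1"
proof -
  have "parking_functions r k 0 = {[]}" by (auto simp: parking_functions_def)
  moreover have "{x \<in> {[] :: int list}. permute_coords id x = x} = {[]}"
    by (auto simp: permute_coords_def)
  moreover have "scale_sym 1 f = f" for f by transfer simp
  ultimately show ?thesis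
    by (simp add: park_ch_def frobenius_ch_action_def frobenius_ch_def perm_character_def
        power_sum_cycle_type_def permutes_empty id_def)
qed

lemma PF_series_power_inverse:
  "PF_series r ^ k * (1 - Abs_fps (\<lambda>m. if m = 0 then 0 else G_sym r k m)) = 1"
proof -
  have nth0: "fps_nth (PF_series r ^ k) 0 = 1"
    by (simp add: PF_series_def park_ch_0 fps_nth_power_0)
  have "1 - Abs_fps (\<lambda>m. if m = 0 then 0 else G_sym r k m) = fps_right_inverse (PF_series r ^ k) 1"
    by (rule fps_ext) (simp add: G_sym_def)
  then show ?thesis using fps_right_inverse[of "PF_series r ^ k" 1] nth0 by simp
qed

end

theory Submission
  imports Defs
begin

text \<open>Let \<open>N = r n - k\<close>. The cyclic group of order \<open>N\<close> acts on words of length \<open>n\<close> over the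
  residues modulo \<open>N\<close> by translation, and this commutes with permuting coordinates. A cycle lemma
  shows that the translates of each word are represented exactly \<open>k\<close> times in \<open>S\<^sub>n\<close>, so \<open>N\<close> times
  the characteristic of \<open>S\<^sub>n\<close> is \<open>k h\<^sub>n[N X]\<close>; Pollak's circle argument is the same
  lemma for \<open>(r, 1)\<close>-parking functions and gives \<open>(r n + 1) F\<^sub>n = h\<^sub>n[(r n + 1) X]\<close>. By Lagrange
  inversion the latter determines the coefficients of every power of the generating
  series of the \<open>F\<^sub>n\<close>; those of the power \<open>- k\<close> are \<open>- k h\<^sub>n[(r n - k) X] / (r n - k)\<close>.\<close>

unbundle fps_syntax

section \<open>Cycle sums of permutations\<close>

text \<open>Characteristics are compared through numbers of fixed points, one permutation at a time,
  so no equivariant bijection is needed between the tuples and objects built from parking functions.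
  Inversion uses \<open>h_n[x X]\<close> at negative \<open>x\<close> (\<open>- r\<close> in the
  substituted series, \<open>- k\<close> for the reciprocal), where there are no words to count. It
  is therefore obtained by weighting every cycle with a ring element \<open>x\<close>; this agrees
  with counting words when \<open>x\<close> is a natural number, and its addition law in
  \<open>x\<close> comes directly from splitting the set of cycles. The inversion takes place in a
  commutative ring, so integer factors such as \<open>n\<close> and \<open>r n + 1\<close> stay on
  both sides of the identities and are cancelled by torsion-freeness.\<close>

definition cycle_sum :: "(nat \<Rightarrow> 'a::comm_ring_1) \<Rightarrow> 'b set \<Rightarrow> 'a \<Rightarrow> 'a" where
  "cycle_sum p U x = (\<Sum>\<sigma> | \<sigma> permutes U. \<Prod>c\<in>orbit \<sigma> ` U. x * p (card c))"

text \<open>Conjugation by \<open>f\<close> carries cycles onto cycles of the same size. This later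
  replaces an arbitrary subset by an initial segment of the naturals.\<close>

lemma cycle_sum_cong_card:
  assumes f: "bij_betw f U V"
  shows "cycle_sum p V x = cycle_sum p U x"
proof -
  define g where "g = inv_into U f"
  define conj where "conj = (\<lambda>\<sigma> y. if y \<in> V then f (\<sigma> (g y)) else y)"
  define conj' where "conj' = (\<lambda>\<tau> y. if y \<in> U then g (\<tau> (f y)) else y)"
  have g: "bij_betw g V U" unfolding g_def using f by (rule bij_betw_inv_into)
  have gf: "g (f a) = a" if "a \<in> U" for a
    using that f unfolding g_def by (simp add: bij_betw_inv_into_left)
  have fg: "f (g b) = b" if "b \<in> V" for b
    using that f unfolding g_def by (simp add: bij_betw_inv_into_right)
  have fV: "f a \<in> V" if "a \<in> U" for a using that by (rule bij_betw_apply[OF f])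
  have gU: "g b \<in> U" if "b \<in> V" for b using that by (rule bij_betw_apply[OF g])
  have conj: "conj \<sigma> permutes V" if "\<sigma> permutes U" for \<sigma>
    unfolding conj_def g_def by (rule permutes_bij_inv_into[OF that f])
  have finv: "inv_into V g a = f a" if "a \<in> U" for a
    using that fV gf g by (metis bij_betw_inv_into_left)
  have conj': "conj' \<tau> permutes U" if "\<tau> permutes V" for \<tau>
    using permutes_bij_inv_into[OF that g] unfolding conj'_def by (simp add: finv cong: if_cong)
  have orbit: "orbit (conj \<sigma>) (f a) = f ` orbit \<sigma> a" if \<sigma>: "\<sigma> permutes U" and a: "a \<in> U" for \<sigma> a
  proof -
    have "(conj \<sigma> ^^ i) (f a) = f ((\<sigma> ^^ i) a) \<and> (\<sigma> ^^ i) a \<in> U" for i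
      using a by (induction i) (auto simp: conj_def fV gf permutes_in_image[OF \<sigma>])
    then show ?thesis unfolding orbit_altdef by auto
  qed
  have weight: "(\<Prod>c\<in>orbit (conj \<sigma>) ` V. x * p (card c)) = (\<Prod>c\<in>orbit \<sigma> ` U. x * p (card c))"
    if \<sigma>: "\<sigma> permutes U" for \<sigma>
  proof -
    have sub: "orbit \<sigma> a \<subseteq> U" if "a \<in> U" for a
      using \<sigma> that by (rule permutes_orbit_subset)
    have inj: "inj_on f U" using f by (rule bij_betw_imp_inj_on)
    have "V = f ` U" using f by (simp add: bij_betw_imp_surj_on)
    then have "orbit (conj \<sigma>) ` V = (`) f ` orbit \<sigma> ` U"
      using orbit[OF \<sigma>] by (auto simp: image_image)
    moreover have "inj_on ((`) f) (orbit \<sigma> ` U)"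
      using inj sub by (intro inj_on_subset[OF inj_on_image_Pow]) auto
    moreover have "card (f ` c) = card c" if "c \<in> orbit \<sigma> ` U" for c
      using that sub inj by (intro card_image inj_on_subset[OF inj]) auto
    ultimately show ?thesis by (simp add: prod.reindex)
  qed
  show ?thesis unfolding cycle_sum_def
  proof (rule sum.reindex_bij_witness[of _ conj conj'])
    fix \<tau> assume "\<tau> \<in> {\<tau>. \<tau> permutes V}"
    then have \<tau>: "\<tau> permutes V" by simp
    show inv: "conj (conj' \<tau>) = \<tau>"
      using permutes_in_image[OF \<tau>] permutes_not_in[OF \<tau>]
      by (auto simp: fun_eq_iff conj_def conj'_def fg gU)
    show "conj' \<tau> \<in> {\<sigma>. \<sigma> permutes U}" using conj'[OF \<tau>] by simp
    show "(\<Prod>c\<in>orbit (conj' \<tau>) ` U. x * p (card c)) = (\<Prod>c\<in>orbit \<tau> ` V. x * p (card c))"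
      using weight[OF conj'[OF \<tau>]] by (simp add: inv)
  next
    fix \<sigma> assume "\<sigma> \<in> {\<sigma>. \<sigma> permutes U}"
    then have \<sigma>: "\<sigma> permutes U" by simp
    show "conj' (conj \<sigma>) = \<sigma>"
      using permutes_in_image[OF \<sigma>] permutes_not_in[OF \<sigma>]
      by (auto simp: fun_eq_iff conj_def conj'_def gf fV)
    show "conj \<sigma> \<in> {\<tau>. \<tau> permutes V}" using conj[OF \<sigma>] by simp
  qed
qed

lemma permutes_invariant_restrict:
  assumes "\<sigma> permutes U" "\<sigma> ` V = V"
  shows "perm_restrict \<sigma> V permutes V"
proof (rule bij_imp_permutes)
  have "inj_on \<sigma> V" using assms(1) by (meson inj_on_subset permutes_inj subset_UNIV)
  then have "bij_betw \<sigma> V V" using assms(2) by (simp add: bij_betw_def)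
  then show "bij_betw (perm_restrict \<sigma> V) V V"
    by (subst bij_betw_cong[of _ _ \<sigma>]) (auto simp: perm_restrict_simps)
qed (simp add: perm_restrict_simps)

lemma orbit_image_perm_restrict:
  assumes "\<sigma> ` V \<subseteq> V"
  shows "orbit (perm_restrict \<sigma> V) ` V = orbit \<sigma> ` V"
proof (rule image_cong[OF refl])
  fix a assume "a \<in> V"
  then show "orbit (perm_restrict \<sigma> V) a = orbit \<sigma> a"
    using assms by (intro orbit_cong0[of a V]) (auto simp: perm_restrict_simps)
qed

lemma orbit_eq_if_mem:
  assumes "finite U" "\<sigma> permutes U" "b \<in> orbit \<sigma> a"
  shows "orbit \<sigma> b = orbit \<sigma> a"
  using assms by (metis cyclic_on_alldef cyclic_on_orbit)

text \<open>A set of cycles is the same thing as an invariant subset, namely its union. Choosing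
  some of the cycles of each permutation thus becomes choosing a subset \<open>V\<close>, which can
  be fixed before the permutation is.\<close>

lemma sum_subsets_orbits:
  fixes F :: "'b set set \<Rightarrow> 'b set set \<Rightarrow> 'a::comm_monoid_add"
  assumes U: "finite U" and \<sigma>: "\<sigma> permutes U"
  shows "(\<Sum>T\<in>Pow (orbit \<sigma> ` U). F T (orbit \<sigma> ` U - T)) =
    (\<Sum>V | V \<subseteq> U \<and> \<sigma> ` V = V. F (orbit \<sigma> ` V) (orbit \<sigma> ` (U - V)))"
proof (rule sum.reindex_bij_witness[of _ "(`) (orbit \<sigma>)" Union])
  have self: "a \<in> orbit \<sigma> a" for a
    using U \<sigma> by (meson permutation_permutes permutation_self_in_orbit)
  have sub: "orbit \<sigma> a \<subseteq> U" if "a \<in> U" for a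
    using \<sigma> that by (rule permutes_orbit_subset)
  note eq = orbit_eq_if_mem[OF U \<sigma>]
  have closed: "orbit \<sigma> a \<subseteq> V" if "\<sigma> ` V = V" "a \<in> V" for a V
  proof
    fix b assume "b \<in> orbit \<sigma> a"
    then show "b \<in> V" using that by induction auto
  qed
  {
    fix T assume "T \<in> Pow (orbit \<sigma> ` U)"
    then have T: "T \<subseteq> orbit \<sigma> ` U" by simp
    have mem: "orbit \<sigma> a \<in> T \<longleftrightarrow> a \<in> \<Union>T" for a
    proof
      assume "a \<in> \<Union>T"
      then obtain c where c: "c \<in> T" "a \<in> c" by blast
      then obtain d where "c = orbit \<sigma> d" using T by blast
      then show "orbit \<sigma> a \<in> T" using c eq by simp
    qed (use self in blast)
    show im: "orbit \<sigma> ` \<Union>T = T"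
    proof (intro equalityI subsetI)
      fix c assume "c \<in> T"
      moreover from this T obtain a where "c = orbit \<sigma> a" by blast
      ultimately show "c \<in> orbit \<sigma> ` \<Union>T" using self by blast
    qed (use mem in blast)
    have "\<sigma> ` \<Union>T \<subseteq> \<Union>T"
    proof
      fix b assume "b \<in> \<sigma> ` \<Union>T"
      then obtain c a where "c \<in> T" "a \<in> c" "b = \<sigma> a" by blast
      moreover from this T obtain d where "c = orbit \<sigma> d" by blast
      ultimately show "b \<in> \<Union>T" by (auto intro: orbit.step)
    qed
    moreover have sU: "\<Union>T \<subseteq> U" using T sub by blast
    then have "finite (\<Union>T)" using U by (rule finite_subset)
    then have "\<sigma> ` \<Union>T = \<Union>T"
      using calculation \<sigma> by (metis endo_inj_surj inj_on_subset permutes_inj subset_UNIV)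
    ultimately show "\<Union>T \<in> {V. V \<subseteq> U \<and> \<sigma> ` V = V}" using sU by simp
    have "orbit \<sigma> ` (U - \<Union>T) = orbit \<sigma> ` U - T"
      using mem by blast
    then show "F (orbit \<sigma> ` \<Union>T) (orbit \<sigma> ` (U - \<Union>T)) = F T (orbit \<sigma> ` U - T)"
      by (simp add: im)
  }
  fix V assume "V \<in> {V. V \<subseteq> U \<and> \<sigma> ` V = V}"
  then have V: "V \<subseteq> U" "\<sigma> ` V = V" by auto
  show "\<Union>(orbit \<sigma> ` V) = V" using closed[OF V(2)] self by blast
  show "orbit \<sigma> ` V \<in> Pow (orbit \<sigma> ` U)" using V by blast
qed

text \<open>Expanding the product over cycles colours each cycle with \<open>x\<close> or
  \<open>y\<close>. Let \<open>V\<close> be the union of the cycles coloured \<open>x\<close>: a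
  permutation stabilising \<open>V\<close> is a pair of independent permutations of \<open>V\<close>
  and \<open>U - V\<close>, so the inner sum factors.\<close>

lemma cycle_sum_add:
  fixes U :: "'b set"
  assumes U: "finite U"
  shows "cycle_sum p U (x + y) = (\<Sum>V\<in>Pow U. cycle_sum p V x * cycle_sum p (U - V) y)"
proof -
  define w where "w = (\<lambda>x (T :: 'b set set). \<Prod>c\<in>T. x * p (card c))"
  have perms: "finite {\<sigma>. \<sigma> permutes V}" if "V \<subseteq> U" for V
    using finite_subset[OF that U] by (rule finite_permutations)
  have "cycle_sum p U (x + y) =
      (\<Sum>\<sigma> | \<sigma> permutes U. \<Sum>T\<in>Pow (orbit \<sigma> ` U). w x T * w y (orbit \<sigma> ` U - T))"
    unfolding cycle_sum_def w_def by (simp add: distrib_right prod_add U)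
  also have "\<dots> = (\<Sum>\<sigma> | \<sigma> permutes U. \<Sum>V | V \<subseteq> U \<and> \<sigma> ` V = V.
      w x (orbit \<sigma> ` V) * w y (orbit \<sigma> ` (U - V)))"
    by (intro sum.cong refl sum_subsets_orbits[OF U, where F = "\<lambda>S T. w x S * w y T"]) simp
  also have "\<dots> = (\<Sum>V\<in>Pow U. \<Sum>\<sigma> | \<sigma> permutes U \<and> \<sigma> ` V = V.
      w x (orbit \<sigma> ` V) * w y (orbit \<sigma> ` (U - V)))"
    using sum.swap_restrict[of "{\<sigma>. \<sigma> permutes U}" "Pow U"
        "\<lambda>\<sigma> V. w x (orbit \<sigma> ` V) * w y (orbit \<sigma> ` (U - V))" "\<lambda>\<sigma> V. \<sigma> ` V = V"]
      U perms[of U] by simp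
  also have "\<dots> = (\<Sum>V\<in>Pow U. cycle_sum p V x * cycle_sum p (U - V) y)"
  proof (rule sum.cong[OF refl])
    fix V assume "V \<in> Pow U"
    then have V: "V \<subseteq> U" by simp
    have "(\<Sum>\<sigma> | \<sigma> permutes U \<and> \<sigma> ` V = V. w x (orbit \<sigma> ` V) * w y (orbit \<sigma> ` (U - V))) =
      (\<Sum>(\<alpha>, \<beta>)\<in>{\<alpha>. \<alpha> permutes V} \<times> {\<beta>. \<beta> permutes U - V}. w x (orbit \<alpha> ` V) * w y (orbit \<beta> ` (U - V)))"
    proof (rule sum.reindex_bij_witness[of _ "\<lambda>(\<alpha>, \<beta>). \<alpha> \<circ> \<beta>"
          "\<lambda>\<sigma>. (perm_restrict \<sigma> V, perm_restrict \<sigma> (U - V))"])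
      fix \<sigma> assume "\<sigma> \<in> {\<sigma>. \<sigma> permutes U \<and> \<sigma> ` V = V}"
      then have \<sigma>: "\<sigma> permutes U" and inv: "\<sigma> ` V = V" by auto
      have inv': "\<sigma> ` (U - V) = U - V"
        using \<sigma> inv by (metis image_set_diff permutes_image permutes_inj)
      show "(case (perm_restrict \<sigma> V, perm_restrict \<sigma> (U - V)) of (\<alpha>, \<beta>) \<Rightarrow> \<alpha> \<circ> \<beta>) = \<sigma>"
        using \<sigma> V perm_restrict_union[OF permutes_invariant_restrict[OF \<sigma> inv]
            permutes_invariant_restrict[OF \<sigma> inv']]
        by (simp add: Un_absorb1 perm_restrict_id)
      show "(perm_restrict \<sigma> V, perm_restrict \<sigma> (U - V)) \<in>
          {\<alpha>. \<alpha> permutes V} \<times> {\<beta>. \<beta> permutes U - V}"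
        using permutes_invariant_restrict[OF \<sigma> inv] permutes_invariant_restrict[OF \<sigma> inv'] by simp
      show "(case (perm_restrict \<sigma> V, perm_restrict \<sigma> (U - V)) of
          (\<alpha>, \<beta>) \<Rightarrow> w x (orbit \<alpha> ` V) * w y (orbit \<beta> ` (U - V))) =
          w x (orbit \<sigma> ` V) * w y (orbit \<sigma> ` (U - V))"
        by (simp add: orbit_image_perm_restrict inv inv')
    next
      fix q assume "q \<in> {\<alpha>. \<alpha> permutes V} \<times> {\<beta>. \<beta> permutes U - V}"
      then obtain \<alpha> \<beta> where q: "q = (\<alpha>, \<beta>)" and \<alpha>: "\<alpha> permutes V" and \<beta>: "\<beta> permutes U - V"
        by blast
      have 1: "(\<alpha> \<circ> \<beta>) a = \<alpha> a" if "a \<in> V" for a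
        using that permutes_not_in[OF \<beta>] by simp
      have 2: "(\<alpha> \<circ> \<beta>) a = \<beta> a" if "a \<notin> V" for a
      proof -
        have "\<beta> a \<notin> V" using that permutes_in_image[OF \<beta>, of a] permutes_not_in[OF \<beta>, of a] by (cases "a \<in> U") auto
        then show ?thesis using permutes_not_in[OF \<alpha>] by simp
      qed
      have "perm_restrict (\<alpha> \<circ> \<beta>) V = \<alpha>"
        using 1 permutes_not_in[OF \<alpha>] by (fastforce simp: fun_eq_iff perm_restrict_def)
      moreover have "perm_restrict (\<alpha> \<circ> \<beta>) (U - V) = \<beta>"
        using 2 permutes_not_in[OF \<beta>] by (fastforce simp: fun_eq_iff perm_restrict_def)
      ultimately show "(perm_restrict (case q of (\<alpha>, \<beta>) \<Rightarrow> \<alpha> \<circ> \<beta>) V,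
          perm_restrict (case q of (\<alpha>, \<beta>) \<Rightarrow> \<alpha> \<circ> \<beta>) (U - V)) = q"
        by (simp add: q)
      have "\<alpha> \<circ> \<beta> permutes U"
        using permutes_subset[OF \<alpha> V] permutes_subset[OF \<beta>, of U] by (simp add: permutes_compose)
      moreover have "(\<alpha> \<circ> \<beta>) ` V = V"
        using 1 permutes_image[OF \<alpha>] by (metis image_cong)
      ultimately show "(case q of (\<alpha>, \<beta>) \<Rightarrow> \<alpha> \<circ> \<beta>) \<in> {\<sigma>. \<sigma> permutes U \<and> \<sigma> ` V = V}"
        by (simp add: q)
    qed
    also have "\<dots> = cycle_sum p V x * cycle_sum p (U - V) y"
      by (simp add: cycle_sum_def w_def sum_product sum.cartesian_product)
    finally show "(\<Sum>\<sigma> | \<sigma> permutes U \<and> \<sigma> ` V = V. w x (orbit \<sigma> ` V) * w y (orbit \<sigma> ` (U - V))) =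
      cycle_sum p V x * cycle_sum p (U - V) y" .
  qed
  finally show ?thesis .
qed

text \<open>After division by factorials this is a Cauchy product, which makes the series of the
  \<open>h_n[x X]\<close> multiplicative in \<open>x\<close>.\<close>

lemma cycle_sum_add_binomial:
  fixes x y :: "'a::comm_ring_1"
  shows "cycle_sum p {..<n} (x + y) =
    (\<Sum>i\<le>n. of_nat (n choose i) * (cycle_sum p {..<i} x * cycle_sum p {..<n - i} y))"
proof -
  have card: "cycle_sum p V x = cycle_sum p {..<card V} x" if "finite V" for V :: "nat set" and x
    using ex_bij_betw_nat_finite[OF that] cycle_sum_cong_card
    by (metis atLeast0LessThan)
  have "cycle_sum p {..<n} (x + y) =
      (\<Sum>V\<in>Pow {..<n}. cycle_sum p {..<card V} x * cycle_sum p {..<n - card V} y)"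
    unfolding cycle_sum_add[OF finite_lessThan]
  proof (rule sum.cong[OF refl])
    fix V assume "V \<in> Pow {..<n}"
    then have "V \<subseteq> {..<n}" by simp
    moreover from this have "finite V" by (rule finite_subset) simp
    ultimately show "cycle_sum p V x * cycle_sum p ({..<n} - V) y =
        cycle_sum p {..<card V} x * cycle_sum p {..<n - card V} y"
      using card[of V x] card[of "{..<n} - V" y] by (simp add: card_Diff_subset)
  qed
  also have "\<dots> = (\<Sum>i\<le>n. \<Sum>V | V \<in> Pow {..<n} \<and> card V = i.
      cycle_sum p {..<card V} x * cycle_sum p {..<n - card V} y)"
    by (rule sum.group[symmetric]) (auto intro: order_trans[OF card_mono[of "{..<n}"]])
  also have "\<dots> = (\<Sum>i\<le>n. of_nat (n choose i) * (cycle_sum p {..<i} x * cycle_sum p {..<n - i} y))"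
    by (intro sum.cong refl) (simp add: n_subsets)
  finally show ?thesis .
qed

section \<open>Lagrange inversion for a one-parameter group of power series\<close>

lemma fps_X_mult_power_nth:
  "((fps_X * d) ^ s :: 'a::comm_ring_1 fps) $ n = (if n < s then 0 else (d ^ s) $ (n - s))"
  by (simp add: power_mult_distrib fps_X_power_mult_nth)

text \<open>Powers beyond \<open>m\<close> do not reach the coefficient at \<open>m\<close>, so all
  coefficients up to \<open>n\<close> can share one summation range; the interchange of sums in the
  product rule relies on this.\<close>

lemma fps_compose_X_mult_nth:
  fixes a d :: "'a::comm_ring_1 fps"
  assumes "m \<le> n"
  shows "(a oo (fps_X * d)) $ m = (\<Sum>i\<le>n. a $ i * ((fps_X * d) ^ i) $ m)"
  unfolding fps_compose_nth
  using assms by (intro sum.mono_neutral_left) (auto simp: fps_X_mult_power_nth)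

text \<open>Both sides expand into the terms \<open>a $ i * b $ j * (c ^ (i + j)) $ n\<close>. Those
  with \<open>i + j > n\<close> vanish, which cuts the square of indices down to the triangle that
  the product \<open>a * b\<close> produces.\<close>

lemma fps_compose_X_mult_distrib:
  fixes a b d :: "'a::comm_ring_1 fps"
  shows "(a * b) oo (fps_X * d) = (a oo (fps_X * d)) * (b oo (fps_X * d))"
proof (rule fps_ext)
  fix n
  define c where "c = fps_X * d"
  have "((a oo c) * (b oo c)) $ n =
      (\<Sum>m=0..n. (\<Sum>i\<le>n. a $ i * (c ^ i) $ m) * (\<Sum>j\<le>n. b $ j * (c ^ j) $ (n - m)))"
    unfolding c_def fps_mult_nth by (intro sum.cong refl) (simp add: fps_compose_X_mult_nth[of _ n])
  also have "\<dots> = (\<Sum>m=0..n. \<Sum>i\<le>n. \<Sum>j\<le>n. a $ i * b $ j * ((c ^ i) $ m * (c ^ j) $ (n - m)))"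
    by (simp add: sum_product mult_ac)
  also have "\<dots> = (\<Sum>i\<le>n. \<Sum>j\<le>n. \<Sum>m=0..n. a $ i * b $ j * ((c ^ i) $ m * (c ^ j) $ (n - m)))"
    by (rule trans[OF sum.swap], rule sum.cong[OF refl], rule sum.swap)
  also have "\<dots> = (\<Sum>i\<le>n. \<Sum>j\<le>n. a $ i * b $ j * (c ^ (i + j)) $ n)"
    by (simp add: power_add fps_mult_nth sum_distrib_left)
  also have "\<dots> = (\<Sum>(i, j)\<in>{..n} \<times> {..n}. a $ i * b $ j * (c ^ (i + j)) $ n)"
    by (simp add: sum.cartesian_product)
  also have "\<dots> = (\<Sum>(i, j)\<in>{(i, j). i + j \<le> n}. a $ i * b $ j * (c ^ (i + j)) $ n)"
    by (intro sum.mono_neutral_right) (auto simp: c_def fps_X_mult_power_nth split: if_splits)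
  also have "\<dots> = (\<Sum>s\<le>n. \<Sum>i\<le>s. a $ i * b $ (s - i) * (c ^ s) $ n)"
    unfolding sum.triangle_reindex_eq by (intro sum.cong refl) simp
  also have "\<dots> = ((a * b) oo c) $ n"
    unfolding fps_compose_nth fps_mult_nth sum_distrib_right atLeast0AtMost ..
  finally show "((a * b) oo (fps_X * d)) $ n = ((a oo (fps_X * d)) * (b oo (fps_X * d))) $ n"
    by (simp add: c_def)
qed

lemma fps_compose_X_mult_power:
  fixes a d :: "'a::comm_ring_1 fps"
  shows "a ^ k oo (fps_X * d) = (a oo (fps_X * d)) ^ k"
  by (induction k) (simp_all add: fps_compose_X_mult_distrib)

lemma fps_X_deriv_nth: "(fps_X * fps_deriv a) $ n = of_nat n * (a :: 'a::comm_ring_1 fps) $ n"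
  by (cases n) simp_all

lemma fps_of_int_mult_nth: "(of_int c * a) $ n = of_int c * (a :: 'a::comm_ring_1 fps) $ n"
  by (simp flip: fps_of_int)

lemma fps_of_nat_mult_nth: "(of_nat c * a) $ n = of_nat c * (a :: 'a::comm_ring_1 fps) $ n"
  by (simp flip: fps_of_nat)

text \<open>Models the integer powers \<open>H^x\<close> of one series \<open>H\<close> with
  constant term 1; \<open>E (- x)\<close> serves as the reciprocal of \<open>E x\<close>.\<close>

locale fps_one_parameter_group =
  fixes E :: "int \<Rightarrow> 'a::comm_ring_1 fps"
  assumes zero: "E 0 = 1"
    and add: "E (x + y) = E x * E y"
    and nth_0: "E x $ 0 = 1"
    and torsion_free: "0 < m \<Longrightarrow> of_nat m * (a :: 'a) = 0 \<Longrightarrow> a = 0"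
begin

lemma cancel_of_nat:
  assumes "0 < m" "of_nat m * a = of_nat m * (b :: 'a)"
  shows "a = b"
proof -
  have "of_nat m * (a - b) = 0" using assms(2) by (simp add: right_diff_distrib)
  then have "a - b = 0" by (rule torsion_free[OF assms(1)])
  then show ?thesis by simp
qed

definition logderiv :: "'a fps" where
  "logderiv = fps_deriv (E 1) * E (- 1)"

text \<open>The logarithmic derivative \<open>D x\<close> is additive in \<open>x\<close>, hence
  equals \<open>x\<close> times its value at 1.\<close>

lemma deriv: "fps_deriv (E x) = of_int x * logderiv * E x"
proof -
  define D where "D x = fps_deriv (E x) * E (- x)" for x
  have inv: "E x * E (- x) = 1" for x
    by (simp add: zero flip: add)
  have D_add: "D (x + y) = D x + D y" for x y
  proof -
    have "D (x + y) = (E x * E (- x)) * D y + (E y * E (- y)) * D x"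
      using add[of "- x" "- y"] by (simp add: D_def add algebra_simps)
    then show ?thesis by (simp add: inv)
  qed
  have D0: "D 0 = 0" by (simp add: D_def zero)
  have D_minus: "D (- x) = - D x" for x
    using D_add[of x "- x"] D0 by (simp add: add_eq_0_iff)
  have D_nat: "D (int m) = of_nat m * D 1" for m
    by (induction m) (simp_all add: D0 D_add algebra_simps)
  have "D x = of_int x * D 1"
    by (cases x rule: int_cases2) (simp_all add: D_nat D_minus)
  moreover have "fps_deriv (E x) = D x * E x"
  proof -
    have "D x * E x = fps_deriv (E x) * (E x * E (- x))" by (simp add: D_def mult_ac)
    then show ?thesis by (simp add: inv)
  qed
  moreover have "D 1 = logderiv" by (simp add: D_def logderiv_def)
  ultimately show ?thesis by (simp only:)
qed

lemma power: "E x ^ m = E (int m * x)"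
  by (induction m) (simp_all add: zero algebra_simps add)

text \<open>The residue of \<open>K' / f^n\<close> for \<open>f = X * E (- r)\<close>: it extracts \<open>n\<close> times the
  \<open>n\<close>-th coefficient of the expansion of \<open>K\<close> in powers of \<open>f\<close>.\<close>

definition lagrange :: "nat \<Rightarrow> 'a fps \<Rightarrow> nat \<Rightarrow> 'a" where
  "lagrange r K n = (fps_X * fps_deriv K * E (int r * int n)) $ n"

lemma lagrange_nth:
  "lagrange r K n = (\<Sum>i\<le>n. of_nat i * K $ i * E (int r * int n) $ (n - i))"
  unfolding lagrange_def fps_mult_nth[of _ _ n] fps_X_deriv_nth atLeast0AtMost ..

lemma lagrange_diff: "lagrange r (K - L) n = lagrange r K n - lagrange r L n"
  by (simp add: lagrange_nth algebra_simps sum_subtractf)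

text \<open>\<open>fps_deriv (E a) * E (r n)\<close> and \<open>fps_deriv (E (r n + a))\<close> are
  the multiples of \<open>logderiv * E (r n + a)\<close> by \<open>a\<close> and by
  \<open>r n + a\<close>. Cross-multiplying compares them without a division.\<close>

lemma lagrange_E:
  "of_int (int r * int n + a) * lagrange r (E a) n = of_int a * of_nat n * E (int r * int n + a) $ n"
proof -
  define b where "b = int r * int n + a"
  have "of_int b * (fps_X * fps_deriv (E a) * E (int r * int n)) = of_int a * (fps_X * fps_deriv (E b))"
    unfolding deriv by (simp add: b_def add algebra_simps)
  then have "(of_int b * (fps_X * fps_deriv (E a) * E (int r * int n))) $ n =
      (of_int a * (fps_X * fps_deriv (E b))) $ n" by simp
  then show ?thesis
    unfolding fps_of_int_mult_nth fps_X_deriv_nth by (simp add: lagrange_def b_def mult.assoc)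
qed

text \<open>The powers of \<open>f\<close> are dual to these functionals because a derivative has no
  residue. With \<open>m = n - j\<close>, the series inside \<open>lagrange\<close> is
  \<open>j X^j M\<close>, and \<open>m M\<close> equals \<open>m E (r m)\<close> minus the Euler
  derivative of \<open>E (r m)\<close>, whose coefficient at \<open>m\<close> is zero. For
  \<open>m = 0\<close> the constant term 1 of \<open>M\<close> gives the value
  \<open>n\<close>.\<close>

lemma lagrange_power:
  assumes "j \<le> n"
  shows "lagrange r ((fps_X * E (- int r)) ^ j) n = (if j = n then of_nat n else 0)"
proof -
  define m where "m = n - j"
  have n: "n = j + m" using assms by (simp add: m_def)
  define M where "M = E (int r * int m) - of_nat r * (fps_X * (logderiv * E (int r * int m)))"
  have XD: "fps_X * fps_deriv (fps_X ^ j) = of_nat j * (fps_X ^ j :: 'a fps)"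
    by (rule fps_ext) (simp only: fps_X_deriv_nth fps_of_nat_mult_nth fps_X_power_nth, simp)
  have XD_power: "fps_X * fps_deriv ((fps_X * E (- int r)) ^ j) =
      of_nat j * (fps_X ^ j * (E (- (int r * int j)) - of_nat r * (fps_X * (logderiv * E (- (int r * int j))))))"
  proof -
    have "fps_X * fps_deriv ((fps_X * E (- int r)) ^ j) =
        fps_X ^ j * (fps_X * fps_deriv (E (- (int r * int j)))) +
        (fps_X * fps_deriv (fps_X ^ j)) * E (- (int r * int j))"
      by (simp add: power_mult_distrib power algebra_simps)
    then show ?thesis unfolding XD deriv by (simp add: algebra_simps)
  qed
  have E_m: "E (int r * int m) = E (- (int r * int j)) * E (int r * int n)"
    by (simp add: n algebra_simps flip: add)
  have "fps_X * fps_deriv ((fps_X * E (- int r)) ^ j) * E (int r * int n) =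
      of_nat j * (fps_X ^ j * M)"
    unfolding XD_power M_def E_m by (simp only: algebra_simps)
  then have eq: "lagrange r ((fps_X * E (- int r)) ^ j) n = of_nat j * M $ m"
    by (simp add: lagrange_def fps_of_nat_mult_nth fps_X_power_mult_nth n)
  have "of_nat m * M = of_nat m * E (int r * int m) - fps_X * fps_deriv (E (int r * int m))"
    by (simp add: deriv M_def algebra_simps)
  then have M_m: "(of_nat m * M) $ m = 0"
    by (simp only: fps_sub_nth fps_of_nat_mult_nth fps_X_deriv_nth) simp
  have "M $ m = 0" if "m > 0"
    by (rule torsion_free[OF that]) (use M_m in \<open>simp add: fps_of_nat_mult_nth\<close>)
  moreover have "M $ 0 = 1"
    by (simp add: M_def nth_0 fps_of_nat_mult_nth)
  ultimately show ?thesis using eq n by (cases m) auto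
qed

lemma lagrange_compose: "lagrange r (c oo (fps_X * E (- int r))) n = of_nat n * c $ n"
proof -
  define f where "f = fps_X * E (- int r)"
  have "lagrange r (c oo f) n =
      (\<Sum>i\<le>n. \<Sum>j\<le>n. c $ j * (of_nat i * (f ^ j) $ i * E (int r * int n) $ (n - i)))"
    unfolding lagrange_nth f_def
    by (intro sum.cong refl) (simp add: fps_compose_X_mult_nth[of _ n] sum_distrib_left
        sum_distrib_right mult_ac)
  also have "\<dots> = (\<Sum>j\<le>n. c $ j * lagrange r (f ^ j) n)"
    by (subst sum.swap) (simp add: lagrange_nth sum_distrib_left)
  also have "\<dots> = (\<Sum>j\<le>n. if j = n then of_nat n * c $ n else 0)"
    by (intro sum.cong refl) (simp add: lagrange_power f_def mult.commute)
  finally show ?thesis by (simp add: f_def)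
qed

text \<open>The functionals are triangular: the top term of the \<open>n\<close>-th one is
  \<open>n * K $ n\<close>, as \<open>E\<close> has constant term 1, and the other terms involve
  earlier coefficients of \<open>K\<close>.\<close>

lemma lagrange_eq_0D:
  assumes "K $ 0 = 0" "\<And>n. lagrange r K n = 0"
  shows "K = 0"
proof (rule fps_ext)
  fix n
  show "K $ n = 0 $ n"
  proof (induction n rule: less_induct)
    case (less n)
    have "lagrange r K n = (\<Sum>i\<le>n. if i = n then of_nat n * K $ n else 0)"
      unfolding lagrange_nth
    proof (intro sum.cong refl)
      fix i assume "i \<in> {..n}"
      then have "i = n \<or> K $ i = 0" using less[of i] by fastforce
      then show "of_nat i * K $ i * E (int r * int n) $ (n - i) =
          (if i = n then of_nat n * K $ n else 0)"
        by (elim disjE) (auto simp: nth_0)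
    qed
    then have "of_nat n * K $ n = 0" using assms(2) by simp
    then have "K $ n = 0" if "0 < n" using that torsion_free by blast
    then show ?case using assms(1) by (cases "n = 0") auto
  qed
qed

text \<open>Both sides have the same constant term and, after multiplication by
  \<open>r n + 1\<close>, the same value under every functional: \<open>lagrange_compose\<close>
  evaluates the left side and \<open>lagrange_E\<close> the right one.\<close>

theorem lagrange_inversion:
  assumes P: "\<And>n. of_nat (r * n + 1) * P $ n = E (int r * int n + 1) $ n"
  shows "P oo (fps_X * E (- int r)) = E 1"
proof -
  define K where "K = (P oo (fps_X * E (- int r))) - E 1"
  have "K $ 0 = 0" using P[of 0] by (simp add: K_def nth_0)
  moreover have "lagrange r K n = 0" for n
  proof (rule torsion_free[of "r * n + 1"])
    have "of_nat (r * n + 1) * lagrange r K n =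
        of_nat n * (of_nat (r * n + 1) * P $ n) - of_int (int r * int n + 1) * lagrange r (E 1) n"
      by (simp add: K_def lagrange_diff lagrange_compose algebra_simps)
    also have "\<dots> = 0" unfolding P lagrange_E by simp
    finally show "of_nat (r * n + 1) * lagrange r K n = 0" .
  qed simp
  ultimately have "K = 0" by (rule lagrange_eq_0D)
  then show ?thesis by (simp add: K_def)
qed

text \<open>Substituting \<open>f\<close> turns \<open>P ^ k\<close> into \<open>E k\<close>, so it
  turns \<open>Q\<close> into \<open>E (- k)\<close>. Applying the functionals to this expansion
  reads off the coefficients of \<open>Q\<close>.\<close>

corollary lagrange_inversion_reciprocal:
  assumes P: "\<And>n. of_nat (r * n + 1) * P $ n = E (int r * int n + 1) $ n"
    and Q: "P ^ k * Q = 1" and n: "0 < n"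
  shows "of_int (int r * int n - int k) * Q $ n = - (of_nat k * E (int r * int n - int k) $ n)"
proof -
  define f where "f = fps_X * E (- int r)"
  have "(P ^ k oo f) * (Q oo f) = 1"
    unfolding f_def by (simp flip: fps_compose_X_mult_distrib add: Q)
  then have "E (int k) * (Q oo f) = 1"
    unfolding f_def by (simp add: fps_compose_X_mult_power lagrange_inversion[OF P] power)
  then have "E (- int k) * (E (int k) * (Q oo f)) = E (- int k)" by simp
  then have "Q oo f = E (- int k)"
    by (simp add: zero flip: mult.assoc add)
  then have Qn: "lagrange r (E (- int k)) n = of_nat n * Q $ n"
    using lagrange_compose[of r Q n] by (simp add: f_def)
  have "of_nat n * (of_int (int r * int n - int k) * Q $ n) =
      of_int (int r * int n + - int k) * lagrange r (E (- int k)) n"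
    unfolding Qn by (simp only: diff_conv_add_uminus mult.left_commute)
  also have "\<dots> = of_nat n * - (of_nat k * E (int r * int n - int k) $ n)"
    unfolding lagrange_E by (simp add: algebra_simps)
  finally show ?thesis by (rule cancel_of_nat[OF n])
qed

end

section \<open>Words with a dominated letter count and the cycle lemma\<close>

lemma cycle_lemma:
  fixes P :: "nat \<Rightarrow> int"
  assumes N: "0 < N" and period: "\<And>j. P (j + N) = P j + int k"
  shows "card {(v, w). v < N \<and> w \<in> {1..int k} \<and> (\<forall>t\<in>{1..N}. w \<le> P (v + t) - P v)} = k"
proof -
  \<comment> \<open>Since \<open>P\<close> drifts upwards, \<open>I v\<close> is the infimum of all later values \<open>P j\<close>, \<open>j \<ge> v\<close>.
    The admissible \<open>w\<close> at \<open>v\<close> number \<open>I (v + 1) - I v\<close>, and these telescope over a period.\<close>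
  define I where "I v = Min (P ` {v..<v + N})" for v
  define W where "W v = {w \<in> {1..int k}. \<forall>t\<in>{1..N}. w \<le> P (v + t) - P v}" for v
  have I_rec: "I v = min (P v) (I (Suc v))" for v
  proof -
    \<comment> \<open>Passing to the next window trades \<open>v\<close> for \<open>v + N\<close>,
      whose value \<open>P v + k\<close> cannot lower the minimum. Hence a minimum over one period
      is already the infimum of all later values.\<close>
    have "insert v {Suc v..<Suc v + N} = insert (v + N) {v..<v + N}" using N by auto
    then have "Min (insert (P v) (P ` {Suc v..<Suc v + N})) = Min (insert (P (v + N)) (P ` {v..<v + N}))"
      by (metis image_insert)
    then have "min (P v) (I (Suc v)) = min (P v + int k) (I v)"
      using N by (simp add: I_def period)
    moreover have "I v \<le> P v" unfolding I_def using N by (intro Min_le) auto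
    ultimately show ?thesis by linarith
  qed
  have card_W: "int (card (W v)) = I (Suc v) - I v" for v
  proof -
    have le: "x \<le> I (Suc v) \<longleftrightarrow> (\<forall>t\<in>{1..N}. x \<le> P (v + t))" for x
    proof -
      have "{Suc v..<Suc v + N} = (+) v ` {1..N}"
        by (simp add: atLeastLessThanSuc_atLeastAtMost add.commute)
      then have "I (Suc v) = Min ((\<lambda>t. P (v + t)) ` {1..N})"
        unfolding I_def by (simp only: image_image)
      then show ?thesis using N by simp
    qed
    \<comment> \<open>The instance \<open>t = N\<close> makes the upper bound \<open>k\<close> on
      \<open>w\<close> automatic.\<close>
    have "I (Suc v) \<le> P v + int k"
      using le[of "I (Suc v)"] N by (auto simp: period[symmetric])
    then have "w \<in> W v \<longleftrightarrow> w \<in> {1..I (Suc v) - P v}" for w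
      using le[of "w + P v"] unfolding W_def mem_Collect_eq le_diff_eq atLeastAtMost_iff by linarith
    then have "W v = {1..I (Suc v) - P v}" by (rule set_eqI)
    then show ?thesis using I_rec[of v] by simp
  qed
  have I_period: "I N = I 0 + int k"
  proof -
    have "{N..<N + N} = (\<lambda>j. j + N) ` {0..<N}" by simp
    then have "I N = Min ((\<lambda>x. x + int k) ` P ` {0..<N})"
      unfolding I_def by (simp only: image_image period)
    also have "\<dots> = Min (P ` {0..<N}) + int k"
      using N by (intro mono_Min_commute[symmetric]) (auto simp: mono_def)
    finally show ?thesis by (simp add: I_def)
  qed
  have fin: "finite (W v)" for v
    unfolding W_def by (rule finite_subset[of _ "{1..int k}"]) auto
  have "{(v, w). v < N \<and> w \<in> {1..int k} \<and> (\<forall>t\<in>{1..N}. w \<le> P (v + t) - P v)} = Sigma {..<N} W"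
    by (auto simp: W_def)
  then have "int (card {(v, w). v < N \<and> w \<in> {1..int k} \<and> (\<forall>t\<in>{1..N}. w \<le> P (v + t) - P v)})
      = (\<Sum>v<N. int (card (W v)))"
    using fin by simp
  also have "\<dots> = int k"
    unfolding card_W using sum_lessThan_telescope[of I N] I_period by simp
  finally show ?thesis by simp
qed

section \<open>Words over the residues modulo N and their translates\<close>

definition words :: "nat \<Rightarrow> nat \<Rightarrow> int list set" where
  "words N n = {y. length y = n \<and> set y \<subseteq> {0..<int N}}"

text \<open>Parking functions correspond to \<open>\<alpha> = 1\<close>, \<open>\<beta> = - r\<close> after the reflection \<open>x \<mapsto> N - x\<close>, and
  the tuples of \<^const>\<open>S_tuples\<close> to \<open>\<alpha> = - 1\<close>, \<open>\<beta> = r\<close> after subtracting \<open>w\<close>.\<close>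

definition dominated_words :: "int \<Rightarrow> int \<Rightarrow> nat \<Rightarrow> nat \<Rightarrow> nat \<Rightarrow> (int list \<times> int) set" where
  "dominated_words \<alpha> \<beta> k N n = {(z, w). z \<in> words N n \<and> w \<in> {1..int k} \<and>
     (\<forall>t\<in>{1..N}. w \<le> \<alpha> * int t + \<beta> * int (length (filter (\<lambda>x. x < int t) z)))}"

lemma finite_words: "finite (words N n)"
proof -
  have "words N n = {y. set y \<subseteq> {0..<int N} \<and> length y = n}" by (auto simp: words_def)
  then show ?thesis by (simp add: finite_lists_length_eq)
qed

definition rotate_word :: "nat \<Rightarrow> int \<Rightarrow> int list \<Rightarrow> int list" where
  "rotate_word N v y = map (\<lambda>x. (x + v) mod int N) y"

lemma rotate_word_in_words: "0 < N \<Longrightarrow> y \<in> words N n \<Longrightarrow> rotate_word N v y \<in> words N n"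
  by (auto simp: words_def rotate_word_def)

lemma rotate_word_inverse: "y \<in> words N n \<Longrightarrow> rotate_word N (- v) (rotate_word N v y) = y"
  by (auto simp: words_def rotate_word_def mod_simps intro!: map_idI)

lemma length_filter_less_Suc:
  "length (filter (\<lambda>x. f x < int (Suc t)) y) =
    length (filter (\<lambda>x. f x < int t) y) + length (filter (\<lambda>x. f x = int t) y)"
  by (induction y) auto

text \<open>\<open>cnt\<close> counts letters while walking around the circle of residues, continued
  past \<open>N\<close>. Translating by \<open>- v\<close> turns the number of letters below
  \<open>t\<close> into the increment of \<open>cnt\<close> from \<open>v\<close> to
  \<open>v + t\<close>, so domination is the condition of the cycle lemma for \<open>P\<close>,
  whose drift over one turn is \<open>total\<close>.\<close>

lemma card_dominated_rotations:
  assumes N: "0 < N" and y: "y \<in> words N n" and total: "\<alpha> * int N + \<beta> * int n = int k"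
  shows "card {(v, w). v < N \<and> (rotate_word N (- int v) y, w) \<in> dominated_words \<alpha> \<beta> k N n} = k"
proof -
  define cnt where "cnt j = (\<Sum>i<j. length (filter (\<lambda>x. x = int (i mod N)) y))" for j
  define P where "P j = \<alpha> * int j + \<beta> * int (cnt j)" for j
  have y': "length y = n" "\<And>x. x \<in> set y \<Longrightarrow> 0 \<le> x \<and> x < int N" using y by (auto simp: words_def)
  have cnt_add: "cnt (v + t) = cnt v + length (filter (\<lambda>x. (x - int v) mod int N < int t) y)"
    if "t \<le> N" for v t
    using that
  proof (induction t)
    case 0
    have "\<not> (x - int v) mod int N < 0" for x using N by (simp add: not_less)
    then show ?case by simp
  next
    case (Suc t)
    have "x = int ((v + t) mod N) \<longleftrightarrow> (x - int v) mod int N = int t" if "x \<in> set y" for x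
    proof -
      have "(x - int v) mod int N = int t \<longleftrightarrow> (x - int v) mod int N = int t mod int N"
        using Suc.prems by simp
      also have "\<dots> \<longleftrightarrow> x mod int N = (int v + int t) mod int N"
        by (simp add: mod_eq_dvd_iff algebra_simps)
      also have "x mod int N = x" using y'(2)[OF that] by simp
      finally show ?thesis by (simp add: zmod_int)
    qed
    then have "filter (\<lambda>x. x = int ((v + t) mod N)) y = filter (\<lambda>x. (x - int v) mod int N = int t) y"
      by (intro filter_cong) auto
    then have "cnt (v + Suc t) = cnt (v + t) + length (filter (\<lambda>x. (x - int v) mod int N = int t) y)"
      by (simp add: cnt_def)
    then show ?case using Suc by (simp only: length_filter_less_Suc)
  qed
  have cnt_period: "cnt (v + N) = cnt v + n" for v
    using cnt_add[of N v] N y'(1) by simp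
  have "P (j + N) = P j + int k" for j
    unfolding P_def total[symmetric] cnt_period by (simp add: algebra_simps)
  note card = cycle_lemma[of N P k, OF N this]
  have "(rotate_word N (- int v) y, w) \<in> dominated_words \<alpha> \<beta> k N n \<longleftrightarrow>
      w \<in> {1..int k} \<and> (\<forall>t\<in>{1..N}. w \<le> P (v + t) - P v)" for v w
  proof -
    have "P (v + t) - P v = \<alpha> * int t + \<beta> * int (length (filter (\<lambda>x. x < int t) (rotate_word N (- int v) y)))"
      if "t \<le> N" for t
      unfolding P_def cnt_add[OF that]
      by (simp add: rotate_word_def filter_map comp_def algebra_simps)
    then have "(\<forall>t\<in>{1..N}. w \<le> P (v + t) - P v) \<longleftrightarrow> (\<forall>t\<in>{1..N}. w \<le>
        \<alpha> * int t + \<beta> * int (length (filter (\<lambda>x. x < int t) (rotate_word N (- int v) y))))"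
      by (intro ball_cong refl) (simp only: atLeastAtMost_iff)
    then show ?thesis
      unfolding dominated_words_def using rotate_word_in_words[OF N y, of "- int v"] by blast
  qed
  with card show ?thesis by (simp only:)
qed

section \<open>Fixed points of a permutation on words\<close>

lemma permute_coords_map:
  assumes "\<sigma> permutes {..<length y}"
  shows "permute_coords \<sigma> (map f y) = map f (permute_coords \<sigma> y)"
  unfolding permute_coords_def using permute_list_map[OF permutes_inv[OF assms], of f] .

text \<open>Double counting of triples \<open>(v, z, w)\<close>: translating \<open>z\<close> by
  \<open>v\<close> gives a word \<open>y\<close> that is again fixed, and each \<open>y\<close>
  arises \<open>k\<close> times by the cycle lemma. No orbit representatives have to be
  chosen.\<close>

lemma card_dominated_words_fixed:
  assumes N: "0 < N" and total: "\<alpha> * int N + \<beta> * int n = int k" and \<sigma>: "\<sigma> permutes {..<n}"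
  shows "N * card {(z, w) \<in> dominated_words \<alpha> \<beta> k N n. permute_coords \<sigma> z = z} =
    k * card {y \<in> words N n. permute_coords \<sigma> y = y}"
proof -
  define B where "B = {(z, w) \<in> dominated_words \<alpha> \<beta> k N n. permute_coords \<sigma> z = z}"
  define Y where "Y = {y \<in> words N n. permute_coords \<sigma> y = y}"
  define R where
    "R y = {(v, w). v < N \<and> (rotate_word N (- int v) y, w) \<in> dominated_words \<alpha> \<beta> k N n}" for y
  have fixed: "permute_coords \<sigma> (rotate_word N v y) = rotate_word N v y"
    if "y \<in> words N n" "permute_coords \<sigma> y = y" for y v
    using that \<sigma> by (simp add: rotate_word_def permute_coords_map words_def)
  have words: "z \<in> words N n" if "(z, w) \<in> dominated_words \<alpha> \<beta> k N n" for z w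
    using that by (simp add: dominated_words_def)
  have inv: "rotate_word N (- int v) (rotate_word N (int v) y) = y" if "(y, w) \<in> dominated_words \<alpha> \<beta> k N n" for y v w
    using words[OF that] by (rule rotate_word_inverse)
  have inv': "rotate_word N (int v) (rotate_word N (- int v) y) = y" if "y \<in> words N n" for y v
    using rotate_word_inverse[OF that, of "- int v"] by simp
  have "bij_betw (\<lambda>(v, z, w). (rotate_word N (int v) z, v, w)) ({..<N} \<times> B) (Sigma Y R)"
    by (rule bij_betw_byWitness[where f' = "\<lambda>(y, v, w). (v, rotate_word N (- int v) y, w)"])
      (auto simp: B_def Y_def R_def fixed words rotate_word_in_words[OF N] inv inv')
  from bij_betw_same_card[OF this] have "N * card B = card (Sigma Y R)"
    by (simp add: card_cartesian_product)
  moreover have "finite (R y)" if "y \<in> Y" for y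
    by (rule finite_subset[of _ "{..<N} \<times> {1..int k}"]) (auto simp: R_def dominated_words_def)
  moreover have "card (R y) = k" if "y \<in> Y" for y
    unfolding R_def using that by (intro card_dominated_rotations N total) (simp add: Y_def)
  moreover have "finite Y" by (simp add: Y_def finite_words)
  ultimately show ?thesis by (simp add: B_def Y_def)
qed

text \<open>A word is fixed exactly when it is constant on cycles, that is, when it is a colouring
  of the set of cycles with \<open>N\<close> letters.\<close>

lemma card_words_fixed:
  assumes \<sigma>: "\<sigma> permutes {..<n}"
  shows "card {y \<in> words N n. permute_coords \<sigma> y = y} = N ^ card (orbit \<sigma> ` {..<n})"
proof -
  define C where "C = orbit \<sigma> ` {..<n}"
  define h where "h = (\<lambda>g. map (\<lambda>i. g (orbit \<sigma> i)) [0..<n] :: int list)"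
  have perm: "permutation \<sigma>" using \<sigma> by (meson finite_lessThan permutation_permutes)
  have fixed_iff: "permute_coords \<sigma> y = y \<longleftrightarrow> (\<forall>i<n. y ! (\<sigma> i) = y ! i)" if "length y = n" for y :: "int list"
  proof -
    have "permute_coords \<sigma> y = y \<longleftrightarrow> (\<forall>i<n. y ! (inv \<sigma> i) = y ! i)"
      using that \<sigma> by (auto simp: permute_coords_def list_eq_iff_nth_eq permute_list_nth permutes_inv)
    also have "\<dots> \<longleftrightarrow> (\<forall>i<n. y ! (\<sigma> i) = y ! i)"
      by (metis \<sigma> lessThan_iff permutes_in_image permutes_inverses)
    finally show ?thesis .
  qed
  have "bij_betw h (C \<rightarrow>\<^sub>E {0..<int N}) {y \<in> words N n. permute_coords \<sigma> y = y}"
    unfolding bij_betw_def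
  proof (intro conjI equalityI subsetI)
    show "inj_on h (C \<rightarrow>\<^sub>E {0..<int N})"
    proof (rule inj_onI)
      fix g g' assume g: "g \<in> C \<rightarrow>\<^sub>E {0..<int N}" "g' \<in> C \<rightarrow>\<^sub>E {0..<int N}" and eq: "h g = h g'"
      show "g = g'"
      proof (rule PiE_ext[OF g])
        fix c assume "c \<in> C"
        then obtain i where i: "i < n" "c = orbit \<sigma> i" by (auto simp: C_def)
        then show "g c = g' c" using arg_cong[OF eq, of "\<lambda>l. l ! i"] by (simp add: h_def)
      qed
    qed
  next
    fix y assume "y \<in> h ` (C \<rightarrow>\<^sub>E {0..<int N})"
    then obtain g where g: "g \<in> C \<rightarrow>\<^sub>E {0..<int N}" and y: "y = h g" by blast
    have "y ! (\<sigma> i) = y ! i" if "i < n" for i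
    proof -
      have "\<sigma> i < n" using permutes_in_image[OF \<sigma>, of i] that by simp
      then show ?thesis using that by (simp add: y h_def permutation_orbit_step[OF perm])
    qed
    then show "y \<in> {y \<in> words N n. permute_coords \<sigma> y = y}"
      using g fixed_iff[of y] by (auto simp: y h_def words_def C_def)
  next
    fix y assume "y \<in> {y \<in> words N n. permute_coords \<sigma> y = y}"
    then have y: "length y = n" "set y \<subseteq> {0..<int N}" and inv: "\<And>i. i < n \<Longrightarrow> y ! (\<sigma> i) = y ! i"
      using fixed_iff by (auto simp: words_def)
    have orbit: "j < n \<and> y ! j = y ! i" if "j \<in> orbit \<sigma> i" "i < n" for i j
      using that
    proof induction
      case base
      then show ?case using inv permutes_in_image[OF \<sigma>, of i] by simp
    next
      case (step j)
      then show ?case using inv permutes_in_image[OF \<sigma>, of j] by simp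
    qed
    define g where "g = restrict (\<lambda>c. y ! (SOME i. i \<in> c)) C"
    have g: "g (orbit \<sigma> i) = y ! i" if "i < n" for i
    proof -
      have "(SOME j. j \<in> orbit \<sigma> i) \<in> orbit \<sigma> i"
        using orbit_nonempty[of \<sigma> i] by (simp add: some_in_eq)
      then show ?thesis using orbit that by (simp add: g_def C_def)
    qed
    then have "y = h g" using y(1) by (simp add: h_def list_eq_iff_nth_eq)
    moreover have "g \<in> C \<rightarrow>\<^sub>E {0..<int N}"
    proof (rule PiE_I)
      fix c assume "c \<in> C"
      then obtain i where "i < n" "c = orbit \<sigma> i" by (auto simp: C_def)
      then show "g c \<in> {0..<int N}" using g[of i] y nth_mem[of i y] by (auto simp del: nth_mem)
    qed (simp add: g_def)
    ultimately show "y \<in> h ` (C \<rightarrow>\<^sub>E {0..<int N})" by blast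
  qed
  from bij_betw_same_card[OF this] show ?thesis
    by (simp add: card_PiE C_def)
qed

section \<open>Parking functions and the tuples in terms of letter counts\<close>

text \<open>The entries below \<open>x\<close> form an initial segment. This is the dictionary
  between bounds on the sorted entries and bounds on letter counts.\<close>

lemma sorted_nth_less_iff:
  fixes b :: "int list"
  assumes "sorted b" "i < length b"
  shows "b ! i < x \<longleftrightarrow> i < length (filter (\<lambda>y. y < x) b)"
  using assms
proof (induction b arbitrary: i)
  case (Cons y b)
  show ?case
  proof (cases "y < x")
    case True
    then show ?thesis using Cons by (cases i) simp_all
  next
    case False
    then have "filter (\<lambda>y. y < x) b = []" using Cons.prems(1) by (auto simp: filter_empty_conv)
    moreover have "y \<le> (y # b) ! i" using Cons.prems by (cases i) auto
    ultimately show ?thesis using False by simp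
  qed
qed simp

lemma sort_nth_less_iff:
  fixes a :: "int list"
  assumes "i < length a"
  shows "sort a ! i < x \<longleftrightarrow> i < length (filter (\<lambda>y. y < x) a)"
proof -
  have "length (filter (\<lambda>y. y < x) (sort a)) = length (filter (\<lambda>y. y < x) a)"
    by (simp add: filter_sort)
  then show ?thesis using sorted_nth_less_iff[of "sort a" i x] assms by simp
qed

lemma set_sort_nth:
  fixes a :: "int list"
  assumes "x \<in> set a"
  obtains i where "i < length a" "x = sort a ! i"
  using assms by (metis in_set_conv_nth length_sort set_sort)

text \<open>Passes from positions counted from 1 to list indices counted from 0.\<close>

lemma ball_Suc_atLeastAtMost:
  "(\<forall>j\<in>{Suc q..n}. R j) \<longleftrightarrow> (\<forall>i. q \<le> i \<and> i < n \<longrightarrow> R (Suc i))"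
proof (intro iffI ballI allI impI)
  fix j assume "\<forall>i. q \<le> i \<and> i < n \<longrightarrow> R (Suc i)" "j \<in> {Suc q..n}"
  then show "R j" by (cases j) auto
qed auto

text \<open>At \<open>x = sort a ! i\<close> at most \<open>i\<close> entries lie below
  \<open>x\<close>, so the count inequality bounds that entry. Conversely the entry with index
  \<open>c x\<close> is at least \<open>x\<close>, and if there is none then
  \<open>x \<le> r n + 1\<close> suffices. The range has as many letters as the modulus of the
  circle argument.\<close>

lemma parking_functions_iff:
  "a \<in> parking_functions r 1 n \<longleftrightarrow>
    length a = n \<and> set a \<subseteq> {1..int (r * n + 1)} \<and>
    (\<forall>x\<in>{1..int (r * n + 1)}. x \<le> 1 + int r * int (length (filter (\<lambda>y. y < x) a)))"
    (is "_ \<longleftrightarrow> _ \<and> ?range \<and> ?dom")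
proof (cases "length a = n")
  case len: True
  define c where "c x = length (filter (\<lambda>y. y < x) a)" for x
  have sort_less: "sort a ! i < x \<longleftrightarrow> i < c x" if "i < n" for i x
    unfolding c_def using that len by (intro sort_nth_less_iff) simp
  have "(\<forall>j\<in>{1..n}. sort a ! (j - 1) \<le> int 1 + (int j - 1) * int r) \<longleftrightarrow>
      (\<forall>i<n. sort a ! i \<le> 1 + int r * int i)"
    using ball_Suc_atLeastAtMost[of 0 n "\<lambda>j. sort a ! (j - 1) \<le> int 1 + (int j - 1) * int r"]
    by (simp add: mult.commute)
  then have PF: "a \<in> parking_functions r 1 n \<longleftrightarrow>
      (\<forall>x\<in>set a. 1 \<le> x) \<and> (\<forall>i<n. sort a ! i \<le> 1 + int r * int i)"
    using len by (simp add: parking_functions_def)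
  show ?thesis
  proof
    assume "a \<in> parking_functions r 1 n"
    then have pos: "\<And>x. x \<in> set a \<Longrightarrow> 1 \<le> x" and bound: "\<And>i. i < n \<Longrightarrow> sort a ! i \<le> 1 + int r * int i"
      unfolding PF by auto
    have "?range"
    proof
      fix x assume x: "x \<in> set a"
      then obtain i where i: "i < n" "x = sort a ! i" using set_sort_nth len by metis
      have "int r * int i \<le> int r * int n" using i by (intro mult_left_mono) auto
      then show "x \<in> {1..int (r * n + 1)}" using pos[OF x] bound[OF i(1)] i(2) by simp
    qed
    moreover have "?dom"
    proof
      fix x assume x: "x \<in> {1..int (r * n + 1)}"
      have "c x \<le> n" unfolding c_def using len length_filter_le by metis
      then consider "c x = n" | "c x < n" by linarith
      then have "x \<le> 1 + int r * int (c x)"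
      proof cases
        case 1
        then show ?thesis using x by simp
      next
        case 2
        then have "x \<le> sort a ! c x" using sort_less[OF 2, of x] by simp
        then show ?thesis using bound[OF 2] by simp
      qed
      then show "x \<le> 1 + int r * int (length (filter (\<lambda>y. y < x) a))" by (simp add: c_def)
    qed
    ultimately show "length a = n \<and> ?range \<and> ?dom" using len by blast
  next
    assume "length a = n \<and> ?range \<and> ?dom"
    then have range: ?range and dom: "\<And>x. x \<in> {1..int (r * n + 1)} \<Longrightarrow> x \<le> 1 + int r * int (c x)"
      by (auto simp: c_def)
    have "sort a ! i \<le> 1 + int r * int i" if i: "i < n" for i
    proof -
      have "sort a ! i \<in> set a" using i len by (metis length_sort nth_mem set_sort)
      then have "sort a ! i \<le> 1 + int r * int (c (sort a ! i))" using range dom by blast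
      also have "c (sort a ! i) \<le> i" using sort_less[OF i, of "sort a ! i"] by simp
      finally show ?thesis by (simp add: mult_left_mono)
    qed
    then show "a \<in> parking_functions r 1 n" using range unfolding PF by auto
  qed
qed (simp add: parking_functions_def)

lemma S_tuples_iff:
  assumes r: "0 < r" and N0: "0 < N" and N: "int N = int r * int n - int k"
  shows "a \<in> S_tuples r k n \<longleftrightarrow> length a = n \<and>
    (\<exists>w\<in>{1..int k}. set a \<subseteq> {w..<w + int N} \<and>
      (\<forall>t\<in>{1..N}. w \<le> - int t + int r * int (length (filter (\<lambda>y. y < w + int t) a))))"
proof (cases "length a = n")
  case len: True
  define b where "b = sort a"
  define c where "c x = length (filter (\<lambda>y. y < x) a)" for x
  have sort_less: "b ! i < x \<longleftrightarrow> i < c x" if "i < n" for i x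
    unfolding c_def b_def using that len by (intro sort_nth_less_iff) simp
  have c_le: "c x \<le> n" for x unfolding c_def using len length_filter_le by metis
  have "(take (q_min r w) b = replicate (q_min r w) w \<and>
      (\<forall>j\<in>{q_min r w + 1..n}. b ! (j - 1) \<le> min ((int j - 1) * int r) (w - 1 + int r * int n - int k))) \<longleftrightarrow>
    set a \<subseteq> {w..<w + int N} \<and> (\<forall>t\<in>{1..N}. w \<le> - int t + int r * int (c (w + int t)))"
    (is "?take \<and> ?bound \<longleftrightarrow> ?range \<and> ?dom") if w: "w \<in> {1..int k}" for w
  proof -
    define q where "q = q_min r w"
    note q = q_min[OF r, where w = w, folded q_def]
    have q0: "0 < q" using q(1) w by (cases "q = 0") auto
    have qn: "q \<le> n"
    proof (rule ccontr)
      assume "\<not> q \<le> n"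
      then have "int n * int r < w" using q(2)[of n] by simp
      then show False using w N by (simp add: mult.commute)
    qed
    have bound_iff: "?bound \<longleftrightarrow> (\<forall>i. q \<le> i \<and> i < n \<longrightarrow> b ! i \<le> int r * int i \<and> b ! i < w + int N)"
      unfolding q_def[symmetric] Suc_eq_plus1[symmetric] ball_Suc_atLeastAtMost
      by (auto simp: mult.commute N)
    have take_iff: "?take \<longleftrightarrow> (\<forall>i<q. b ! i = w)"
      unfolding q_def[symmetric] using qn len by (auto simp: b_def list_eq_iff_nth_eq)
    have sorted: "b ! i \<le> b ! j" if "i \<le> j" "j < n" for i j
      using that len unfolding b_def by (intro sorted_nth_mono) auto
    show ?thesis
    proof
      assume "?take \<and> ?bound"
      then have eq: "\<And>i. i < q \<Longrightarrow> b ! i = w"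
        and le: "\<And>i. q \<le> i \<Longrightarrow> i < n \<Longrightarrow> b ! i \<le> int r * int i"
        and lt: "\<And>i. q \<le> i \<Longrightarrow> i < n \<Longrightarrow> b ! i < w + int N"
        unfolding take_iff bound_iff by auto
      have ?range
      proof
        fix x assume "x \<in> set a"
        then obtain i where i: "i < n" "x = b ! i" using set_sort_nth len unfolding b_def by metis
        have "w \<le> b ! i" using sorted[of 0 i] eq[of 0] q0 i by simp
        moreover have "b ! i < w + int N"
          using eq[of i] lt[of i] i N0 by (cases "i < q") auto
        ultimately show "x \<in> {w..<w + int N}" using i by simp
      qed
      moreover have "w \<le> - int t + int r * int (c (w + int t))" if t: "t \<in> {1..N}" for t
      \<comment> \<open>If all entries lie below \<open>w + t\<close>, the claim is
        \<open>w + t \<le> k + N = r n\<close>. Otherwise the entry with index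
        \<open>c (w + t)\<close> exceeds \<open>w\<close>, so it lies beyond the initial run and its
        own bound applies.\<close>
      proof (cases "c (w + int t) = n")
        case True
        then show ?thesis using t w N by simp
      next
        case False
        then have lt: "c (w + int t) < n" using c_le[of "w + int t"] by linarith
        then have ge: "w + int t \<le> b ! c (w + int t)" using sort_less[OF lt, of "w + int t"] by simp
        then have "q \<le> c (w + int t)" using eq[of "c (w + int t)"] t by (cases "c (w + int t) < q") auto
        then show ?thesis using le lt ge by fastforce
      qed
      ultimately show "?range \<and> ?dom" by blast
    next
      assume "?range \<and> ?dom"
      then have range: ?range and "?dom" by auto
      then have dom: "w + int t \<le> int r * int (c (w + int t))" if "t \<in> {1..N}" for t
        using that by fastforce
      have b_range: "w \<le> b ! i \<and> b ! i < w + int N" if "i < n" for i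
      proof -
        have "b ! i \<in> set a" using that len unfolding b_def by (metis length_sort nth_mem set_sort)
        then show ?thesis using range by auto
      qed
      have "b ! i = w" if i: "i < q" for i
      proof -
        \<comment> \<open>The case \<open>t = 1\<close> alone forces the initial run: fewer than
          \<open>q\<close> copies of \<open>w\<close> would contradict the minimality of
          \<open>q\<close>.\<close>
        have "i < c (w + 1)"
        proof (rule ccontr)
          assume "\<not> i < c (w + 1)"
          then have "c (w + 1) < q" using i by simp
          then have "int (c (w + 1)) * int r < w" by (rule q(2))
          then show False using dom[of 1] N0 by (simp add: mult.commute)
        qed
        then show ?thesis using sort_less[of i "w + 1"] b_range[of i] i qn by simp
      qed
      moreover have "b ! i \<le> int r * int i" if i: "q \<le> i" "i < n" for i
      proof (cases "b ! i = w")
        case True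
        have "int q * int r \<le> int i * int r" using i by (intro mult_right_mono) auto
        then show ?thesis using True q(1) by (simp add: mult.commute)
      next
        case False
        define t where "t = nat (b ! i - w)"
        have t: "b ! i = w + int t" "t \<in> {1..N}" using False b_range[OF i(2)] by (auto simp: t_def)
        have "c (w + int t) \<le> i" using sort_less[OF i(2), of "w + int t"] t by simp
        then have "int r * int (c (w + int t)) \<le> int r * int i" by (intro mult_left_mono) auto
        then show ?thesis using dom[OF t(2)] t(1) by simp
      qed
      ultimately show "?take \<and> ?bound" unfolding take_iff bound_iff using b_range by blast
    qed
  qed
  then show ?thesis using len unfolding S_tuples_def b_def c_def by auto
qed (simp add: S_tuples_def)

section \<open>Frobenius characteristics\<close>

lemma scale_sym_0: "scale_sym 0 f = 0"
  by transfer simp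

lemma scale_sym_1: "scale_sym 1 f = f"
  by transfer simp

lemma scale_sym_add: "scale_sym (a + b) f = scale_sym a f + scale_sym b f"
  by transfer (simp add: fun_eq_iff distrib_right)

lemma scale_sym_add_right: "scale_sym a (f + g) = scale_sym a f + scale_sym a g"
  by transfer (simp add: fun_eq_iff distrib_left)

lemma scale_sym_scale_sym: "scale_sym a (scale_sym b f) = scale_sym (a * b) f"
  by transfer (simp add: fun_eq_iff mult.assoc)

lemma scale_sym_mult_left: "scale_sym a f * g = scale_sym a (f * g)"
  by transfer (simp add: fun_eq_iff conv_mset_def sum_distrib_left mult.assoc)

lemma scale_sym_mult_right: "f * scale_sym a g = scale_sym a (f * g)"
  by (metis mult.commute scale_sym_mult_left)

lemma scale_sym_zero_right: "scale_sym a 0 = 0"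
  by transfer simp

lemma scale_sym_sum: "scale_sym a (sum f A) = (\<Sum>x\<in>A. scale_sym a (f x))"
  by (induction A rule: infinite_finite_induct) (simp_all add: scale_sym_zero_right scale_sym_add_right)

lemma scale_sym_of_nat: "scale_sym (of_nat m) f = of_nat m * f"
  by (induction m) (simp_all add: scale_sym_0 scale_sym_1 scale_sym_add algebra_simps)

lemma symfun_torsion_free:
  assumes "0 < m" "of_nat m * f = (0 :: symfun)"
  shows "f = 0"
proof -
  have "scale_sym (1 / of_nat m) (scale_sym (of_nat m) f) = f"
    using assms(1) by (simp add: scale_sym_scale_sym scale_sym_1)
  then show ?thesis using assms(2) by (simp add: scale_sym_of_nat scale_sym_zero_right)
qed

text \<open>In plethystic notation, \<open>word_ch n x\<close> is \<open>h\<^sub>n[x X]\<close>; for a natural number \<open>x\<close> it is the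
  Frobenius characteristic of the words of length \<open>n\<close> over \<open>x\<close> letters.\<close>

definition word_ch :: "nat \<Rightarrow> symfun \<Rightarrow> symfun" where
  "word_ch n x = scale_sym (1 / fact n) (cycle_sum power_sum {..<n} x)"

lemma cycle_sum_empty: "cycle_sum p {} x = 1"
  by (simp add: cycle_sum_def)

lemma cycle_sum_zero:
  assumes "finite U" "U \<noteq> {}"
  shows "cycle_sum p U 0 = 0"
  using assms unfolding cycle_sum_def by (intro sum.neutral ballI) (simp add: power_0_left)

lemma word_ch_add: "word_ch n (x + y) = (\<Sum>i\<le>n. word_ch i x * word_ch (n - i) y)"
proof -
  have "word_ch n (x + y) = (\<Sum>i\<le>n. scale_sym (1 / fact n * of_nat (n choose i))
      (cycle_sum power_sum {..<i} x * cycle_sum power_sum {..<n - i} y))"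
    by (simp only: word_ch_def cycle_sum_add_binomial scale_sym_sum scale_sym_scale_sym
        flip: scale_sym_of_nat)
  also have "\<dots> = (\<Sum>i\<le>n. word_ch i x * word_ch (n - i) y)"
    by (intro sum.cong refl) (simp add: word_ch_def scale_sym_mult_left scale_sym_mult_right
        scale_sym_scale_sym binomial_fact mult.commute)
  finally show ?thesis .
qed

text \<open>The series at \<open>x\<close> is the \<open>x\<close>-th power of the generating series
  of the complete homogeneous functions. At \<open>x = 0\<close> only the constant term survives,
  since a permutation of a nonempty set has a cycle.\<close>

interpretation word_series: fps_one_parameter_group "\<lambda>x. Abs_fps (\<lambda>n. word_ch n (of_int x))"
proof
  show "Abs_fps (\<lambda>n. word_ch n (of_int 0)) = 1"
  proof (rule fps_ext)
    fix n
    show "Abs_fps (\<lambda>n. word_ch n (of_int 0)) $ n = 1 $ n"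
      by (cases "n = 0") (simp_all add: word_ch_def cycle_sum_empty cycle_sum_zero lessThan_empty_iff
          scale_sym_1 scale_sym_zero_right)
  qed
  show "Abs_fps (\<lambda>n. word_ch n (of_int (x + y))) =
      Abs_fps (\<lambda>n. word_ch n (of_int x)) * Abs_fps (\<lambda>n. word_ch n (of_int y))" for x y
    by (simp add: fps_eq_iff fps_mult_nth word_ch_add atLeast0AtMost)
  show "Abs_fps (\<lambda>n. word_ch n (of_int x)) $ 0 = 1" for x
    by (simp add: word_ch_def cycle_sum_empty scale_sym_1)
qed (rule symfun_torsion_free)

section \<open>From fixed-point counts to characteristics\<close>

lemma cycle_sum_of_nat:
  "cycle_sum power_sum {..<n} (of_nat N) = (\<Sum>\<sigma> | \<sigma> permutes {..<n}.
    scale_sym (of_nat (N ^ card (orbit \<sigma> ` {..<n}))) (power_sum_cycle_type n \<sigma>))"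
  unfolding cycle_sum_def power_sum_cycle_type_def scale_sym_of_nat
  by (simp add: prod.distrib)

text \<open>The factor \<open>N\<close> per cycle is absorbed into the cycle weights, so the sum
  over permutations is the cycle sum at \<open>x = N\<close>.\<close>

lemma frobenius_ch_proportional:
  assumes "\<And>\<sigma>. \<sigma> permutes {..<n} \<Longrightarrow>
    of_nat N * \<chi> \<sigma> = (of_nat (k * N ^ card (orbit \<sigma> ` {..<n})) :: rat)"
  shows "of_nat N * frobenius_ch n \<chi> = of_nat k * word_ch n (of_nat N)"
proof -
  have "of_nat N * frobenius_ch n \<chi> = scale_sym (1 / fact n)
      (\<Sum>\<sigma> | \<sigma> permutes {..<n}. scale_sym (of_nat N * \<chi> \<sigma>) (power_sum_cycle_type n \<sigma>))"
    by (simp add: frobenius_ch_def scale_sym_sum scale_sym_scale_sym mult_ac flip: scale_sym_of_nat)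
  also have "\<dots> = scale_sym (1 / fact n) (\<Sum>\<sigma> | \<sigma> permutes {..<n}.
      scale_sym (of_nat (k * N ^ card (orbit \<sigma> ` {..<n}))) (power_sum_cycle_type n \<sigma>))"
    using assms by (intro arg_cong[where f = "scale_sym _"] sum.cong) auto
  also have "\<dots> = of_nat k * word_ch n (of_nat N)"
    unfolding word_ch_def cycle_sum_of_nat
    by (simp add: scale_sym_sum scale_sym_scale_sym mult_ac flip: scale_sym_of_nat)
  finally show ?thesis .
qed

lemma frobenius_ch_action_dominated:
  assumes N: "0 < N" and total: "\<alpha> * int N + \<beta> * int n = int k"
    and X: "\<And>\<sigma>. \<sigma> permutes {..<n} \<Longrightarrow> card {x \<in> X. permute_coords \<sigma> x = x} =
      card {(z, w) \<in> dominated_words \<alpha> \<beta> k N n. permute_coords \<sigma> z = z}"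
  shows "of_nat N * frobenius_ch_action n X = of_nat k * word_ch n (of_nat N)"
  unfolding frobenius_ch_action_def
proof (rule frobenius_ch_proportional)
  fix \<sigma> assume \<sigma>: "\<sigma> permutes {..<n}"
  show "of_nat N * perm_character X \<sigma> = (of_nat (k * N ^ card (orbit \<sigma> ` {..<n})) :: rat)"
    unfolding perm_character_def X[OF \<sigma>] of_nat_mult[symmetric]
    by (simp only: card_dominated_words_fixed[OF N total \<sigma>] card_words_fixed[OF \<sigma>])
qed

text \<open>Parking functions must have many small entries, whereas domination with
  \<open>\<alpha> = 1\<close>, \<open>\<beta> = - r\<close> demands few small letters; the
  reflection \<open>x \<mapsto> N - x\<close> exchanges the two. The drift \<open>N - r n\<close> is
  1, so \<open>w = 1\<close> is the only choice.\<close>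

lemma park_ch_word_ch: "of_nat (r * n + 1) * park_ch r 1 n = word_ch n (of_nat (r * n + 1))"
proof -
  define N where "N = r * n + 1"
  define f where "f a = map (\<lambda>x. int N - x) a" for a
  have length_f: "length (f a) = length a" for a by (simp add: f_def)
  have ff: "f (f a) = a" for a by (simp add: f_def map_idI)
  have iff: "(f a, 1) \<in> dominated_words 1 (- int r) 1 N n \<longleftrightarrow> a \<in> parking_functions r 1 n" for a
  proof (cases "length a = n")
    case len: True
    have filter: "length (filter (\<lambda>x. x < int t) (f a)) = n - length (filter (\<lambda>y. y < int N - int t + 1) a)" for t
    proof -
      have "length (filter (\<lambda>x. x < int t) (f a)) = length (filter (\<lambda>y. \<not> y < int N - int t + 1) a)"
        by (auto simp: f_def filter_map comp_def intro!: arg_cong[where f = length] filter_cong)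
      then show ?thesis
        using sum_length_filter_compl[of "\<lambda>y. y < int N - int t + 1" a] len by simp
    qed
    have le: "length (filter P a) \<le> n" for P using len length_filter_le by metis
    have "(1 \<le> 1 * int t + - int r * int (length (filter (\<lambda>x. x < int t) (f a)))) \<longleftrightarrow>
        int N - int t + 1 \<le> 1 + int r * int (length (filter (\<lambda>y. y < int N - int t + 1) a))" for t
      unfolding filter of_nat_diff[OF le] by (auto simp: N_def algebra_simps)
    \<comment> \<open>The thresholds are reflected too: \<open>t \<mapsto> N - t + 1\<close> is an
      involution of \<open>1..N\<close>.\<close>
    moreover have reflect: "(\<forall>t\<in>{1..N}. R (int N - int t + 1)) \<longleftrightarrow> (\<forall>x\<in>{1..int N}. R x)" for R
    proof (intro iffI ballI)
      fix x assume R: "\<forall>t\<in>{1..N}. R (int N - int t + 1)" and x: "x \<in> {1..int N}"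
      then have "nat (int N - x + 1) \<in> {1..N}" by auto
      then have "R (int N - int (nat (int N - x + 1)) + 1)" using R by blast
      then show "R x" using x by simp
    qed auto
    moreover note reflect[of "\<lambda>x. x \<le> 1 + int r * int (length (filter (\<lambda>y. y < x) a))"]
    ultimately have "(\<forall>t\<in>{1..N}. 1 \<le> 1 * int t + - int r * int (length (filter (\<lambda>x. x < int t) (f a)))) \<longleftrightarrow>
        (\<forall>x\<in>{1..int N}. x \<le> 1 + int r * int (length (filter (\<lambda>y. y < x) a)))"
      by (simp only:)
    moreover have "set (f a) \<subseteq> {0..<int N} \<longleftrightarrow> set a \<subseteq> {1..int N}"
      by (auto simp: f_def)
    ultimately show ?thesis
      unfolding dominated_words_def words_def parking_functions_iff mem_Collect_eq prod.case N_def[symmetric]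
      using len by (simp add: length_f del: One_nat_def)
  qed (simp add: dominated_words_def words_def parking_functions_def f_def)
  have "card {a \<in> parking_functions r 1 n. permute_coords \<sigma> a = a} =
      card {(z, w) \<in> dominated_words 1 (- int r) 1 N n. permute_coords \<sigma> z = z}"
    if \<sigma>: "\<sigma> permutes {..<n}" for \<sigma>
  proof (rule bij_betw_same_card[of "\<lambda>a. (f a, 1)"], rule bij_betw_byWitness[where f' = "\<lambda>(z, w). f z"])
    have fixed: "permute_coords \<sigma> (f a) = f a" if "length a = n" "permute_coords \<sigma> a = a" for a
      using that \<sigma> by (simp add: f_def permute_coords_map)
    show "(\<lambda>a. (f a, 1)) ` {a \<in> parking_functions r 1 n. permute_coords \<sigma> a = a} \<subseteq>
        {(z, w) \<in> dominated_words 1 (- int r) 1 N n. permute_coords \<sigma> z = z}"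
      using iff fixed by (auto simp: parking_functions_def)
    have "f z \<in> parking_functions r 1 n \<and> permute_coords \<sigma> (f z) = f z"
      if "(z, w) \<in> dominated_words 1 (- int r) 1 N n" "permute_coords \<sigma> z = z" for z w
    proof -
      have "w = 1" "length z = n" using that by (auto simp: dominated_words_def words_def)
      then show ?thesis using that iff[of "f z"] fixed[of z] by (simp add: ff)
    qed
    then show "(\<lambda>(z, w). f z) ` {(z, w) \<in> dominated_words 1 (- int r) 1 N n. permute_coords \<sigma> z = z} \<subseteq>
        {a \<in> parking_functions r 1 n. permute_coords \<sigma> a = a}"
      by auto
  qed (auto simp: ff dominated_words_def)
  then have "of_nat N * frobenius_ch_action n (parking_functions r 1 n) = of_nat 1 * word_ch n (of_nat N)"
    by (intro frobenius_ch_action_dominated) (auto simp: N_def)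
  then show ?thesis by (simp add: park_ch_def N_def)
qed

text \<open>Dominated words are counted together with \<open>w\<close>, so a tuple must determine
  its \<open>w\<close> for the counts to agree. It does, since \<open>w\<close> is its
  minimum.\<close>

lemma S_tuples_word_ch:
  assumes r: "0 < r" and N0: "0 < N" and N: "int N = int r * int n - int k"
  shows "of_nat N * frobenius_ch_action n (S_tuples r k n) = of_nat k * word_ch n (of_nat N)"
proof (rule frobenius_ch_action_dominated[OF N0])
  show "- 1 * int N + int r * int n = int k" using N by simp
  define f where "f = (\<lambda>(z, w). map (\<lambda>x. x + w) z :: int list)"
  define D where "D = dominated_words (- 1) (int r) k N n"
  have D_iff: "(z, w) \<in> D \<longleftrightarrow> length z = n \<and> set z \<subseteq> {0..<int N} \<and> w \<in> {1..int k} \<and>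
      (\<forall>t\<in>{1..N}. w \<le> - int t + int r * int (length (filter (\<lambda>x. x < int t) z)))" for z w
    by (auto simp: D_def dominated_words_def words_def)
  have in_S: "f (z, w) \<in> S_tuples r k n" if "(z, w) \<in> D" for z w
    unfolding S_tuples_iff[OF r N0 N]
  proof (intro conjI bexI[of _ w])
    show "set (f (z, w)) \<subseteq> {w..<w + int N}" "length (f (z, w)) = n" "w \<in> {1..int k}"
      using that by (auto simp: D_iff f_def)
    show "\<forall>t\<in>{1..N}. w \<le> - int t + int r * int (length (filter (\<lambda>y. y < w + int t) (f (z, w))))"
      using that by (simp add: D_iff f_def filter_map comp_def add.commute)
  qed
  have in_D: "(map (\<lambda>x. x - w) a, w) \<in> D"
    if "length a = n" "w \<in> {1..int k}" "set a \<subseteq> {w..<w + int N}"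
      "\<forall>t\<in>{1..N}. w \<le> - int t + int r * int (length (filter (\<lambda>y. y < w + int t) a))" for a w
  proof -
    have "(\<lambda>x. x - w < int t) = (\<lambda>x. x < w + int t)" for t by auto
    then show ?thesis using that by (auto simp: D_iff filter_map comp_def)
  qed
  have min: "Min (set (f (z, w))) = w" if D: "(z, w) \<in> D" for z w
  proof -
    \<comment> \<open>The inequality at \<open>t = 1\<close> together with \<open>w \<ge> 1\<close>
      forces a letter 0, so the value \<open>w\<close> is attained after the shift.\<close>
    have "w \<le> - 1 + int r * int (length (filter (\<lambda>x. x < 1) z))" and z: "set z \<subseteq> {0..<int N}" "1 \<le> w"
      using D N0 by (auto simp: D_iff dest!: bspec[of _ _ 1])
    then have "filter (\<lambda>x. x < 1) z \<noteq> []" by auto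
    then obtain x where "x \<in> set z" "x < 1" by (auto simp: filter_empty_conv)
    moreover from this z have "x = 0" by fastforce
    ultimately have "0 \<in> set z" by simp
    then have "w \<in> set (f (z, w))" by (force simp: f_def)
    then show ?thesis using z by (intro Min_eqI) (auto simp: f_def)
  qed
  have inj: "inj_on f D"
  proof (rule inj_onI)
    fix p p' assume p: "p \<in> D" "p' \<in> D" and eq: "f p = f p'"
    obtain z w z' w' where zw: "p = (z, w)" "p' = (z', w')" by fastforce
    have "w = w'" using min[of z w] min[of z' w'] p eq by (simp add: zw)
    moreover have "inj (\<lambda>x. x + w)" by (simp add: inj_def)
    ultimately have "z = z'" using eq by (simp add: zw f_def inj_map_eq_map)
    then show "p = p'" using \<open>w = w'\<close> by (simp add: zw)
  qed
  fix \<sigma> assume \<sigma>: "\<sigma> permutes {..<n}"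
  have fixed: "permute_coords \<sigma> (map g a) = map g a"
    if "length a = n" "permute_coords \<sigma> a = a" for a :: "int list" and g :: "int \<Rightarrow> int"
    using that \<sigma> by (simp add: permute_coords_map)
  have "{a \<in> S_tuples r k n. permute_coords \<sigma> a = a} = f ` {(z, w) \<in> D. permute_coords \<sigma> z = z}"
  proof (intro equalityI subsetI)
    fix a assume "a \<in> {a \<in> S_tuples r k n. permute_coords \<sigma> a = a}"
    then obtain w where len: "length a = n" and inv: "permute_coords \<sigma> a = a"
      and "(map (\<lambda>x. x - w) a, w) \<in> D"
      using in_D unfolding mem_Collect_eq S_tuples_iff[OF r N0 N] by blast
    moreover have "a = f (map (\<lambda>x. x - w) a, w)" by (simp add: f_def comp_def)
    ultimately show "a \<in> f ` {(z, w) \<in> D. permute_coords \<sigma> z = z}"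
      using fixed[OF len inv] by (intro image_eqI) auto
  next
    fix a assume "a \<in> f ` {(z, w) \<in> D. permute_coords \<sigma> z = z}"
    then obtain z w where "(z, w) \<in> D" "permute_coords \<sigma> z = z" "a = f (z, w)" by auto
    then show "a \<in> {a \<in> S_tuples r k n. permute_coords \<sigma> a = a}"
      using in_S fixed by (auto simp: D_iff f_def)
  qed
  moreover have "inj_on f {(z, w) \<in> D. permute_coords \<sigma> z = z}"
    by (rule inj_on_subset[OF inj]) auto
  ultimately show "card {a \<in> S_tuples r k n. permute_coords \<sigma> a = a} =
      card {(z, w) \<in> dominated_words (- 1) (int r) k N n. permute_coords \<sigma> z = z}"
    by (simp only: card_image D_def)
qed

lemma G_sym_eq_frobenius_ch:
  assumes n: "0 < n" and r: "0 < r" and N: "int r * int n - int k > 0"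
  shows "G_sym r k n = frobenius_ch_action n (S_tuples r k n)"
proof -
  define N where "N = nat (int r * int n - int k)"
  have N: "0 < N" "int N = int r * int n - int k" using assms by (auto simp: N_def)
  define Q where "Q = fps_right_inverse (PF_series r ^ k) 1"
  have "fps_nth (PF_series r ^ k) 0 = 1"
    by (simp add: PF_series_def park_ch_0 fps_nth_power_0)
  then have Q: "PF_series r ^ k * Q = 1"
    unfolding Q_def by (intro fps_right_inverse) simp
  have P: "of_nat (r * m + 1) * PF_series r $ m =
      Abs_fps (\<lambda>n. word_ch n (of_int (int r * int m + 1))) $ m" for m
    using park_ch_word_ch[of r m] by (simp add: PF_series_def add.commute)
  have "of_int (int N) * Q $ n = - (of_nat k * word_ch n (of_int (int N)))"
    using word_series.lagrange_inversion_reciprocal[OF P Q n] by (simp only: N(2)) simp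
  \<comment> \<open>The minus sign in the definition of \<open>G_sym\<close> cancels the one
    produced by the exponent \<open>- k\<close>.\<close>
  then have "of_nat N * G_sym r k n = of_nat k * word_ch n (of_nat N)"
    by (simp add: G_sym_def Q_def)
  also have "\<dots> = of_nat N * frobenius_ch_action n (S_tuples r k n)"
    by (rule S_tuples_word_ch[OF r N, symmetric])
  finally show ?thesis by (rule word_series.cancel_of_nat[OF N(1)])
qed

text \<open>In a sorted vector the initial run is controlled by its two ends, and the cap
  \<open>w - 1 + r n - k\<close> by the last entry. Entries equal to \<open>w\<close> beyond the run
  obey the staircase bound because \<open>w \<le> q r\<close>.\<close>

lemma sorted_S_tuples_iff:
  fixes b :: "int list"
  assumes n: "0 < n" and r: "0 < r" and N: "int r * int n - int k > 0"
    and b: "length b = n" "sorted b"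
  shows "b \<in> S_tuples r k n \<longleftrightarrow>
    (\<exists>w\<in>{1..int k}. b ! 0 = w \<and> b ! (n - 1) - b ! 0 < int r * int n - int k \<and>
      b ! (q_min r w - 1) = w \<and>
      (\<forall>j\<in>{1..n}. w < b ! (j - 1) \<longrightarrow> b ! (j - 1) \<le> (int j - 1) * int r))"
proof -
  have sort: "sort b = b" using b(2) by (rule sorted_sort_id)
  have mono: "b ! i \<le> b ! j" if "i \<le> j" "j < n" for i j
    using that b by (intro sorted_nth_mono) auto
  have "(take (q_min r w) b = replicate (q_min r w) w \<and>
      (\<forall>j\<in>{q_min r w + 1..n}. b ! (j - 1) \<le> min ((int j - 1) * int r) (w - 1 + int r * int n - int k))) \<longleftrightarrow>
    (b ! 0 = w \<and> b ! (n - 1) - b ! 0 < int r * int n - int k \<and> b ! (q_min r w - 1) = w \<and>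
      (\<forall>j\<in>{1..n}. w < b ! (j - 1) \<longrightarrow> b ! (j - 1) \<le> (int j - 1) * int r))"
    (is "?take \<and> ?bound \<longleftrightarrow> ?first \<and> ?last \<and> ?q \<and> ?steps") if w: "w \<in> {1..int k}" for w
  proof -
    define q where "q = q_min r w"
    note q = q_min[OF r, where w = w, folded q_def]
    have q0: "0 < q" using q(1) w by (cases "q = 0") auto
    have qn: "q \<le> n"
    proof (rule ccontr)
      assume "\<not> q \<le> n"
      then have "int n * int r < w" using q(2)[of n] by simp
      then show False using w N by (simp add: mult.commute)
    qed
    have q_le: "w \<le> int i * int r" if "q \<le> i" for i
      using q(1) that by (meson int_le_induct mult_right_mono of_nat_0_le_iff of_nat_le_iff order_trans)
    have bound_iff: "?bound \<longleftrightarrow> (\<forall>i. q \<le> i \<and> i < n \<longrightarrow> b ! i \<le> int i * int r \<and> b ! i - w < int r * int n - int k)"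
      unfolding q_def[symmetric] Suc_eq_plus1[symmetric] ball_Suc_atLeastAtMost by auto
    have steps_iff: "?steps \<longleftrightarrow> (\<forall>i<n. w < b ! i \<longrightarrow> b ! i \<le> int i * int r)"
      using ball_Suc_atLeastAtMost[of 0 n "\<lambda>j. w < b ! (j - 1) \<longrightarrow> b ! (j - 1) \<le> (int j - 1) * int r"]
      by simp
    have take_iff: "?take \<longleftrightarrow> (\<forall>i<q. b ! i = w)"
      unfolding q_def[symmetric] using qn b by (auto simp: list_eq_iff_nth_eq)
    have first_q_iff: "(\<forall>i<q. b ! i = w) \<longleftrightarrow> b ! 0 = w \<and> b ! (q - 1) = w"
    proof (intro iffI allI impI)
      fix i assume "b ! 0 = w \<and> b ! (q - 1) = w" "i < q"
      then show "b ! i = w" using mono[of 0 i] mono[of i "q - 1"] qn by auto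
    qed (use q0 in auto)
    show ?thesis
    proof
      assume "?take \<and> ?bound"
      then have eq: "\<forall>i<q. b ! i = w" and le: "\<And>i. q \<le> i \<Longrightarrow> i < n \<Longrightarrow> b ! i \<le> int i * int r"
        and lt: "\<And>i. q \<le> i \<Longrightarrow> i < n \<Longrightarrow> b ! i - w < int r * int n - int k"
        unfolding take_iff bound_iff by auto
      have first: ?first and "?q" using eq[unfolded first_q_iff] by (auto simp: q_def)
      moreover have "?steps"
        unfolding steps_iff using eq le by (metis leI less_irrefl)
      moreover have "?last"
        using eq lt[of "n - 1"] first n N by (cases "n - 1 < q") auto
      ultimately show "?first \<and> ?last \<and> ?q \<and> ?steps" by blast
    next
      assume R: "?first \<and> ?last \<and> ?q \<and> ?steps"
      then have "\<forall>i<q. b ! i = w" unfolding first_q_iff by (simp add: q_def)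
      moreover have "b ! i \<le> int i * int r" if i: "q \<le> i" "i < n" for i
      proof (cases "w < b ! i")
        case True
        then show ?thesis using R i unfolding steps_iff by blast
      next
        case False
        then show ?thesis using q_le[OF i(1)] by linarith
      qed
      moreover have "b ! i - w < int r * int n - int k" if "i < n" for i
      proof -
        have "b ! i \<le> b ! (n - 1)" using mono[of i "n - 1"] that by simp
        then show ?thesis using R by linarith
      qed
      ultimately show "?take \<and> ?bound" unfolding take_iff bound_iff by blast
    qed
  qed
  then show ?thesis unfolding S_tuples_def by (simp only: mem_Collect_eq sort b(1) simp_thms cong: bex_cong)
qed

unbundle no fps_syntax

theorem theorem4p1:
  fixes n r k :: nat
  assumes "0 < n" and "0 < r" and "0 < k"
    and "int r * int n - int k > 0"
  shows "G_sym r k n = frobenius_ch_action n (S_tuples r k n) \<and>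
    (\<forall>b :: int list. length b = n \<and> sorted b \<longrightarrow>
      (b \<in> S_tuples r k n \<longleftrightarrow>
        (\<exists>w\<in>{1..int k}.
           b ! 0 = w \<and> b ! (n - 1) - b ! 0 < int r * int n - int k \<and>
           b ! (q_min r w - 1) = w \<and>
           (\<forall>j\<in>{1..n}. w < b ! (j - 1) \<longrightarrow> b ! (j - 1) \<le> (int j - 1) * int r))))"
  using assms by (intro conjI allI impI G_sym_eq_frobenius_ch sorted_S_tuples_iff) auto

end
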